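(* Let $A$ be a C*-algebra, let $G$ be a finite group, and let $\alpha\colon G\to \mathrm{Aut}(A)$ be an action with the Rokhlin property. Then for any finite subset $F\subseteq A\rtimes_\alpha G$ and any $\epsilon>0$ there exist a positive element $a\in A$ and a *-homomorphism $\varphi\colon \mathrm{M}_{|G|}(\overline{aAa})\to A\rtimes_{\alpha}G$ such that $\mathrm{dist}(x, \mathrm{Im}(\varphi))<\epsilon$ for all $x\in F$.
   Context: C*-algebras are not assumed unital or separable. An action $\alpha\colon G\to\mathrm{Aut}(A)$ of a finite group $G$ on a C*-algebra $A$ has the Rokhlin property if for any $\epsilon>0$ and any finite subset $F\subset A$ there exist mutually orthogonal positive contractions $(r_g)_{g\in G}\subset A$ such that (i) $\|\alpha_g(r_h)-r_{gh}\|<\epsilon$ for all $g,h\in G$; (ii) $\|r_ga-ar_g\|<\epsilon$ for all $a\in F$ and $g\in G$; (iii) $\|(\sum_{g\in G} r_g)a-a\|<\epsilon$ for all $a\in F$. Here $\overline{aAa}$ is the hereditary C*-subalgebra of $A$ generated by $a$, $\mathrm{M}_{|G|}(\cdot)$ denotes the algebra of $|G|\times|G|$ matrices, and $A\rtimes_\alpha G$ is the crossed product C*-algebra. *)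

theory Defs
  imports "HOL-Analysis.Analysis" "HOL-Algebra.Group" "Jordan_Normal_Form.Matrix"
begin

(* C*-algebras; no unit and no separability is required. *)
class cstar_algebra = real_normed_algebra + banach +
  fixes scaleC :: "complex \<Rightarrow> 'a \<Rightarrow> 'a"
    and adj :: "'a \<Rightarrow> 'a"
  assumes scaleC_add_right: "scaleC c (x + y) = scaleC c x + scaleC c y"
    and scaleC_add_left: "scaleC (c + d) x = scaleC c x + scaleC d x"
    and scaleC_scaleC: "scaleC c (scaleC d x) = scaleC (c * d) x"
    and scaleC_of_real: "scaleC (complex_of_real r) x = scaleR r x"
    and mult_scaleC_left: "scaleC c x * y = scaleC c (x * y)"
    and mult_scaleC_right: "x * scaleC c y = scaleC c (x * y)"
    and norm_scaleC: "norm (scaleC c x) = cmod c * norm x"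
    and adj_adj: "adj (adj x) = x"
    and adj_add: "adj (x + y) = adj x + adj y"
    and adj_scaleC: "adj (scaleC c x) = scaleC (cnj c) (adj x)"
    and adj_mult: "adj (x * y) = adj y * adj x"
    and cstar_identity: "norm (adj x * x) = (norm x)\<^sup>2"

definition cstar_positive :: "'a::cstar_algebra \<Rightarrow> bool" where
  "cstar_positive a \<longleftrightarrow> (\<exists>b. a = adj b * b)"

definition star_automorphism :: "('a::cstar_algebra \<Rightarrow> 'a) \<Rightarrow> bool" where
  "star_automorphism f \<longleftrightarrow> bij f \<and>
     (\<forall>x y. f (x + y) = f x + f y) \<and> (\<forall>c x. f (scaleC c x) = scaleC c (f x)) \<and>
     (\<forall>x y. f (x * y) = f x * f y) \<and> (\<forall>x. f (adj x) = adj (f x))"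

(* A homomorphism from G into the group of *-automorphisms; the identity
   \<alpha> \<one> = id follows from multiplicativity and bijectivity. *)
definition cstar_action :: "('g, 'm) monoid_scheme \<Rightarrow> ('g \<Rightarrow> 'a::cstar_algebra \<Rightarrow> 'a) \<Rightarrow> bool" where
  "cstar_action G \<alpha> \<longleftrightarrow>
     (\<forall>g\<in>carrier G. star_automorphism (\<alpha> g)) \<and>
     (\<forall>g\<in>carrier G. \<forall>h\<in>carrier G. \<alpha> (g \<otimes>\<^bsub>G\<^esub> h) = \<alpha> g \<circ> \<alpha> h)"

definition rokhlin_property :: "('g, 'm) monoid_scheme \<Rightarrow> ('g \<Rightarrow> 'a::cstar_algebra \<Rightarrow> 'a) \<Rightarrow> bool" where
  "rokhlin_property G \<alpha> \<longleftrightarrow>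
     (\<forall>\<epsilon>>0. \<forall>F. finite F \<longrightarrow>
       (\<exists>r :: 'g \<Rightarrow> 'a.
         (\<forall>g\<in>carrier G. cstar_positive (r g) \<and> norm (r g) \<le> 1) \<and>
         (\<forall>g\<in>carrier G. \<forall>h\<in>carrier G. g \<noteq> h \<longrightarrow> r g * r h = 0) \<and>
         (\<forall>g\<in>carrier G. \<forall>h\<in>carrier G. norm (\<alpha> g (r h) - r (g \<otimes>\<^bsub>G\<^esub> h)) < \<epsilon>) \<and>
         (\<forall>a\<in>F. \<forall>g\<in>carrier G. norm (r g * a - a * r g) < \<epsilon>) \<and>
         (\<forall>a\<in>F. norm ((\<Sum>g\<in>carrier G. r g) * a - a) < \<epsilon>)))"

(* The hereditary C*-subalgebra generated by a positive element a. *)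
definition hereditary :: "'a::cstar_algebra \<Rightarrow> 'a set" where
  "hereditary a = closure (range (\<lambda>x. a * x * a))"

(* The *-algebra of n x n matrices with entries in B: sum and product are those of type mat. *)
definition matrices_over :: "nat \<Rightarrow> 'a set \<Rightarrow> 'a mat set" where
  "matrices_over n B = {M \<in> carrier_mat n n. elements_mat M \<subseteq> B}"

definition mat_scaleC :: "complex \<Rightarrow> 'a::cstar_algebra mat \<Rightarrow> 'a mat" where
  "mat_scaleC c M = map_mat (scaleC c) M"

definition mat_adj :: "'a::cstar_algebra mat \<Rightarrow> 'a mat" where
  "mat_adj M = map_mat adj (transpose_mat M)"

(* The crossed product by a finite group G. A function f on G stands for the sum of the
   f(g) u_g, where u_g a = \<alpha>_g(a) u_g and u_g u_h = u_(gh). As G is finite, the *-algebra of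
   all functions from G to A under twisted convolution is already complete in the norm
   crossed_norm below, so it is the whole crossed product. Functions are kept undefined
   outside the carrier so that equality of elements is equality of functions. *)
definition crossed_carrier :: "('g, 'm) monoid_scheme \<Rightarrow> ('g \<Rightarrow> 'a) set" where
  "crossed_carrier G = carrier G \<rightarrow>\<^sub>E UNIV"

definition crossed_add :: "('g, 'm) monoid_scheme \<Rightarrow> ('g \<Rightarrow> 'a::cstar_algebra) \<Rightarrow> ('g \<Rightarrow> 'a) \<Rightarrow> 'g \<Rightarrow> 'a" where
  "crossed_add G x y = (\<lambda>g\<in>carrier G. x g + y g)"

definition crossed_diff :: "('g, 'm) monoid_scheme \<Rightarrow> ('g \<Rightarrow> 'a::cstar_algebra) \<Rightarrow> ('g \<Rightarrow> 'a) \<Rightarrow> 'g \<Rightarrow> 'a" where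
  "crossed_diff G x y = (\<lambda>g\<in>carrier G. x g - y g)"

definition crossed_scaleC :: "('g, 'm) monoid_scheme \<Rightarrow> complex \<Rightarrow> ('g \<Rightarrow> 'a::cstar_algebra) \<Rightarrow> 'g \<Rightarrow> 'a" where
  "crossed_scaleC G c x = (\<lambda>g\<in>carrier G. scaleC c (x g))"

definition crossed_mult ::
  "('g, 'm) monoid_scheme \<Rightarrow> ('g \<Rightarrow> 'a::cstar_algebra \<Rightarrow> 'a) \<Rightarrow> ('g \<Rightarrow> 'a) \<Rightarrow> ('g \<Rightarrow> 'a) \<Rightarrow> 'g \<Rightarrow> 'a" where
  "crossed_mult G \<alpha> x y =
     (\<lambda>g\<in>carrier G. \<Sum>h\<in>carrier G. x h * \<alpha> h (y (inv\<^bsub>G\<^esub> h \<otimes>\<^bsub>G\<^esub> g)))"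

definition crossed_adj ::
  "('g, 'm) monoid_scheme \<Rightarrow> ('g \<Rightarrow> 'a::cstar_algebra \<Rightarrow> 'a) \<Rightarrow> ('g \<Rightarrow> 'a) \<Rightarrow> 'g \<Rightarrow> 'a" where
  "crossed_adj G \<alpha> x = (\<lambda>g\<in>carrier G. \<alpha> g (adj (x (inv\<^bsub>G\<^esub> g))))"

definition crossed_l1_norm :: "('g, 'm) monoid_scheme \<Rightarrow> ('g \<Rightarrow> 'a::cstar_algebra) \<Rightarrow> real" where
  "crossed_l1_norm G x = (\<Sum>g\<in>carrier G. norm (x g))"

(* C*-seminorms on the Banach *-algebra l^1(G,A): precisely the functions x \<mapsto> norm (\<pi> x) for
   *-representations \<pi> of l^1(G,A) on Hilbert spaces. Domination by the l^1-norm is automatic;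
   it is included so that the supremum in crossed_norm is visibly finite. *)
definition crossed_cstar_seminorm ::
  "('g, 'm) monoid_scheme \<Rightarrow> ('g \<Rightarrow> 'a::cstar_algebra \<Rightarrow> 'a) \<Rightarrow> (('g \<Rightarrow> 'a) \<Rightarrow> real) \<Rightarrow> bool" where
  "crossed_cstar_seminorm G \<alpha> p \<longleftrightarrow>
     (\<forall>x\<in>crossed_carrier G. \<forall>y\<in>crossed_carrier G. p (crossed_add G x y) \<le> p x + p y) \<and>
     (\<forall>c. \<forall>x\<in>crossed_carrier G. p (crossed_scaleC G c x) = cmod c * p x) \<and>
     (\<forall>x\<in>crossed_carrier G. \<forall>y\<in>crossed_carrier G. p (crossed_mult G \<alpha> x y) \<le> p x * p y) \<and>
     (\<forall>x\<in>crossed_carrier G. p (crossed_mult G \<alpha> (crossed_adj G \<alpha> x) x) = (p x)\<^sup>2) \<and>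
     (\<forall>x\<in>crossed_carrier G. p x \<le> crossed_l1_norm G x)"

(* The norm of the crossed product, i.e. of the enveloping C*-algebra of l^1(G,A). *)
definition crossed_norm ::
  "('g, 'm) monoid_scheme \<Rightarrow> ('g \<Rightarrow> 'a::cstar_algebra \<Rightarrow> 'a) \<Rightarrow> ('g \<Rightarrow> 'a) \<Rightarrow> real" where
  "crossed_norm G \<alpha> x = (SUP p\<in>{p. crossed_cstar_seminorm G \<alpha> p}. p x)"

definition crossed_dist ::
  "('g, 'm) monoid_scheme \<Rightarrow> ('g \<Rightarrow> 'a::cstar_algebra \<Rightarrow> 'a) \<Rightarrow> ('g \<Rightarrow> 'a) \<Rightarrow> ('g \<Rightarrow> 'a) set \<Rightarrow> real" where
  "crossed_dist G \<alpha> x S = (INF y\<in>S. crossed_norm G \<alpha> (crossed_diff G x y))"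

(* *-homomorphisms from the n x n matrices over a *-subalgebra B of A to the crossed product;
   as usual for C*-algebras the notion is purely algebraic, continuity being automatic. *)
definition matrix_star_hom ::
  "('g, 'm) monoid_scheme \<Rightarrow> ('g \<Rightarrow> 'a::cstar_algebra \<Rightarrow> 'a) \<Rightarrow> nat \<Rightarrow> 'a set \<Rightarrow> ('a mat \<Rightarrow> 'g \<Rightarrow> 'a) \<Rightarrow> bool" where
  "matrix_star_hom G \<alpha> n B \<phi> \<longleftrightarrow>
     (\<forall>M\<in>matrices_over n B. \<phi> M \<in> crossed_carrier G) \<and>
     (\<forall>M\<in>matrices_over n B. \<forall>N\<in>matrices_over n B. \<phi> (M + N) = crossed_add G (\<phi> M) (\<phi> N)) \<and>
     (\<forall>c. \<forall>M\<in>matrices_over n B. \<phi> (mat_scaleC c M) = crossed_scaleC G c (\<phi> M)) \<and>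
     (\<forall>M\<in>matrices_over n B. \<forall>N\<in>matrices_over n B. \<phi> (M * N) = crossed_mult G \<alpha> (\<phi> M) (\<phi> N)) \<and>
     (\<forall>M\<in>matrices_over n B. \<phi> (mat_adj M) = crossed_adj G \<alpha> (\<phi> M))"

end

theory Submission
  imports Defs "HOL-Computational_Algebra.Polynomial" "HOL-Real_Asymp.Real_Asymp"
begin

text \<open>If \<open>c(g) \<in> A\<close> are elements for which \<open>v\<^sub>g = c(g) u\<^sub>g\<close> satisfies \<open>v\<^sub>g\<^sup>* v\<^sub>h a = \<delta>\<^sub>g\<^sub>h a\<close>, then
  \<open>b \<otimes> e\<^sub>g\<^sub>h \<mapsto> v\<^sub>g b v\<^sub>h\<^sup>*\<close> is a *-homomorphism on matrices over the hereditary subalgebra of \<open>a\<close>.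
  Rokhlin elements \<open>r\<^sub>g\<close> are exactly orthogonal but only approximately permuted by the action. Put
  \<open>c(g) = r\<^sub>g\<^sup>2 \<alpha>\<^sub>g(w\<^sub>g)\<close>: orthogonality gives \<open>v\<^sub>g\<^sup>* v\<^sub>h = 0\<close> for \<open>g \<noteq> h\<close>, and with
  \<open>d\<^sub>g = \<alpha>\<^sub>g\<^sup>-\<^sup>1(r\<^sub>g\<^sup>2)\<close>, which is close to \<open>s\<^sup>2\<close> for \<open>s = r\<^sub>1\<close>, the remaining condition is
  \<open>w\<^sub>g\<^sup>* d\<^sub>g\<^sup>2 w\<^sub>g a = a\<close>. The \<open>w\<^sub>g\<close> are found one after the other by functional calculus, each time
  replacing \<open>a\<close> by an element of its hereditary subalgebra, so that earlier equations persist. Finally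
  \<open>v\<^sub>g a \<approx> r\<^sub>g\<^sup>2 u\<^sub>g\<close>, so \<open>x u\<^sub>k \<approx> \<Sum> r\<^sub>g\<^sup>2 x r\<^sub>g\<^sup>2 u\<^sub>k\<close> is approximated by elements of the image. As
  the norm of the crossed product is dominated by the \<open>\<ell>\<^sup>1\<close>-norm, all estimates take place in \<open>A\<close>.\<close>

section \<open>Self-adjoint contractions and unitaries\<close>

text \<open>The elements d_g are in general not invertible, so the equations for w_g can be exact
  only on elements built from functions that vanish near 0. This is why only the hereditary
  subalgebra of a single \<open>a\<close> is mapped. The d_g need not commute, so there is no common
  functional calculus that solves all equations at once. A step can be repeated only if it returns
  an element that is again close to s^2; as m is close to s^8, this dictates the fourth root. Even
  powers also keep signs harmless: the fourth root of t^8 is t^2 for every t in [-1,1], so a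
  calculus for self-adjoint contractions suffices and no spectrum is ever computed. Its sup norm
  bound comes from writing h as the real part of a unitary of the unitization, on which Chebyshev
  polynomials are explicit.\<close>

lemma adj_zero [simp]: "adj (0::'a::cstar_algebra) = 0"
  using adj_add[of "0::'a" 0] by simp

lemma adj_minus: "adj (- x::'a::cstar_algebra) = - adj x"
  using adj_add[of "- x" x] by (simp add: eq_neg_iff_add_eq_0)

lemma adj_diff: "adj (x - y::'a::cstar_algebra) = adj x - adj y"
  using adj_add[of x "- y"] by (simp add: adj_minus)

lemma adj_scaleR: "adj (r *\<^sub>R x::'a::cstar_algebra) = r *\<^sub>R adj x"
  using adj_scaleC[of "complex_of_real r" x] by (simp add: scaleC_of_real)

lemma adj_sum: "adj (\<Sum>i\<in>I. f i) = (\<Sum>i\<in>I. adj (f i :: 'a::cstar_algebra))"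
  by (induction I rule: infinite_finite_induct) (auto simp: adj_add)

lemma scaleC_zero [simp]: "scaleC c (0::'a::cstar_algebra) = 0"
  using scaleC_add_right[of c "0::'a" 0] by simp

lemma scaleC_diff_right: "scaleC c (x - y::'a::cstar_algebra) = scaleC c x - scaleC c y"
  using scaleC_add_right[of c "x - y" y] by simp

lemma scaleC_sum: "scaleC c (\<Sum>i\<in>I. f i) = (\<Sum>i\<in>I. scaleC c (f i :: 'a::cstar_algebra))"
  by (induction I rule: infinite_finite_induct) (auto simp: scaleC_add_right)

lemma norm_adj [simp]: "norm (adj x) = norm (x::'a::cstar_algebra)"
proof -
  have le: "norm y \<le> norm (adj y)" for y :: 'a
  proof (cases "y = 0")
    case False
    have "norm y * norm y = norm (adj y * y)"
      using cstar_identity[of y] by (simp add: power2_eq_square)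
    also have "\<dots> \<le> norm (adj y) * norm y"
      by (rule norm_mult_ineq)
    finally show ?thesis
      using False by simp
  qed simp
  show ?thesis
    using le[of x] le[of "adj x"] by (simp add: adj_adj)
qed

lemma cstar_zeroI:
  fixes a :: "'a::cstar_algebra"
  assumes "\<And>x. a * x = 0"
  shows "a = 0"
  using cstar_identity[of "adj a"] assms[of "adj a"] by (simp add: adj_adj)

text \<open>Testing with \<open>x = adj a\<close> replaces a unit. Norms of elements obtained by
  functional calculus are later read off from their left multiplication.\<close>

lemma cstar_norm_le:
  fixes a :: "'a::cstar_algebra"
  assumes "0 \<le> c" and "\<And>x. norm (a * x) \<le> c * norm x"
  shows "norm a \<le> c"
proof (cases "a = 0")
  case False
  have "norm a * norm a = norm (a * adj a)"
    using cstar_identity[of "adj a"] by (simp add: adj_adj power2_eq_square)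
  also have "\<dots> \<le> c * norm a"
    using assms(2)[of "adj a"] by simp
  finally show ?thesis
    using False by simp
qed (use assms in simp)

lemma cstar_positive_selfadjoint: "cstar_positive a \<Longrightarrow> adj a = a"
  by (auto simp: cstar_positive_def adj_mult adj_adj)

text \<open>Left multiplication by \<open>h + c (1 - k)\<close>. When \<open>h\<^sup>2 + (1 - k)\<^sup>2 = 1\<close> and \<open>c\<close> is \<open>i\<close> or \<open>- i\<close>, this
  is a unitary of the unitization.\<close>

definition unitary_op :: "complex \<Rightarrow> 'a::cstar_algebra \<Rightarrow> 'a \<Rightarrow> 'a \<Rightarrow> 'a" where
  "unitary_op c h k x = h * x + scaleC c (x - k * x)"

text \<open>\<open>circle\<close> is h^2 + (1 - k)^2 = 1 with the unit cancelled. As all conditions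
  are equations in the *-algebra, an automorphism carries such a pair to another one.\<close>

locale cstar_circle =
  fixes h k :: "'a::cstar_algebra"
  assumes adj_h: "adj h = h" and adj_k: "adj k = k"
    and hk: "h * k = k * h"
    and circle: "h * h + k * k = k + k"
begin

text \<open>The operator preserves \<open>adj x * x\<close>: the mixed terms cancel because
  \<open>cnj c = - c\<close>, and \<open>circle\<close> adds up the two squares.\<close>

lemma norm_unitary_op:
  assumes "c = \<i> \<or> c = - \<i>"
  shows "norm (unitary_op c h k x) = norm x"
proof -
  let ?w = "h * x" and ?z = "x - k * x"
  have c: "cnj c * c = 1" "cnj c = - c" using assms by auto
  have wz: "adj ?w * ?z = adj ?z * ?w"
  proof -
    have "h * (k * x) = k * (h * x)"
      using hk by (metis mult.assoc)
    then show ?thesis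
      by (simp add: adj_mult adj_diff adj_h adj_k algebra_simps)
  qed
  have sq: "adj ?w * ?w + adj ?z * ?z = adj x * x"
  proof -
    have "adj x * (h * h + k * k) * x = adj x * (k + k) * x"
      by (simp add: circle)
    then show ?thesis
      by (simp add: adj_mult adj_diff adj_h adj_k algebra_simps)
  qed
  have "adj (unitary_op c h k x) * unitary_op c h k x
      = adj ?w * ?w + scaleC c (adj ?w * ?z) + scaleC (cnj c) (adj ?z * ?w)
        + scaleC (cnj c * c) (adj ?z * ?z)"
    unfolding unitary_op_def adj_add adj_scaleC
    by (simp add: distrib_left distrib_right mult_scaleC_left mult_scaleC_right scaleC_scaleC scaleC_add_right add.assoc mult.commute[of "cnj c" c])
  also have "scaleC (cnj c * c) (adj ?z * ?z) = adj ?z * ?z"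
    using c scaleC_of_real[of 1 "adj ?z * ?z"] by simp
  also have "scaleC c (adj ?w * ?z) + scaleC (cnj c) (adj ?z * ?w) = 0"
    using scaleC_add_left[of c "- c" "adj ?z * ?w"] scaleC_of_real[of 0 "adj ?z * ?w"]
    by (simp add: wz c)
  then have "adj ?w * ?w + scaleC c (adj ?w * ?z) + scaleC (cnj c) (adj ?z * ?w)
        + adj ?z * ?z = adj ?w * ?w + adj ?z * ?z"
    by (simp add: add.assoc)
  finally have "adj (unitary_op c h k x) * unitary_op c h k x = adj x * x"
    using sq by simp
  then have "(norm (unitary_op c h k x))\<^sup>2 = (norm x)\<^sup>2"
    by (metis cstar_identity)
  then show ?thesis by simp
qed

lemma unitary_op_add: "unitary_op \<i> h k x + unitary_op (- \<i>) h k x = 2 *\<^sub>R (h * x)"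
  using scaleC_add_left[of \<i> "- \<i>" "x - k * x"] scaleC_of_real[of 0 "x - k * x"]
  by (simp add: unitary_op_def scaleR_2 add.commute add.left_commute)

lemma unitary_op_inverse:
  assumes "c = \<i> \<or> c = - \<i>"
  shows "unitary_op (- c) h k (unitary_op c h k x) = x"
proof -
  let ?z = "x - k * x"
  have c: "- c * c = 1" using assms by auto
  have z0: "scaleC c y + scaleC (- c) y = 0" for y :: 'a
    using scaleC_add_left[of c "- c" y] scaleC_of_real[of 0 y] by simp
  have neg: "scaleC (- c) y = - scaleC c y" for y :: 'a
    using z0[of y] by (simp add: eq_neg_iff_add_eq_0 add.commute)
  have "unitary_op (- c) h k (unitary_op c h k x) =
    h * h * x + scaleC c (h * ?z) + scaleC (- c) (h * x - k * (h * x)) + scaleC (- c * c) (?z - k * ?z)"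
  proof -
    have "h * x + scaleC c ?z - k * (h * x + scaleC c ?z)
        = (h * x - k * (h * x)) + scaleC c (?z - k * ?z)"
      by (simp add: distrib_left mult_scaleC_right scaleC_diff_right right_diff_distrib)
    then have "unitary_op (- c) h k (unitary_op c h k x) = h * (h * x + scaleC c ?z)
        + scaleC (- c) ((h * x - k * (h * x)) + scaleC c (?z - k * ?z))"
      by (simp only: unitary_op_def)
    then show ?thesis
      by (simp only: distrib_left mult_scaleC_right scaleC_add_right scaleC_scaleC mult.assoc add.assoc)
  qed
  also have "scaleC (- c * c) (?z - k * ?z) = ?z - k * ?z"
    using c scaleC_of_real[of 1 "?z - k * ?z"] by simp
  also have "h * x - k * (h * x) = h * ?z"
    using hk by (simp add: right_diff_distrib mult.assoc[symmetric])
  also have "h * h * x + scaleC c (h * ?z) + scaleC (- c) (h * ?z) + (?z - k * ?z)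
      = h * h * x + (?z - k * ?z)"
    by (simp add: neg)
  also have "\<dots> = (h * h + k * k) * x + x - (k + k) * x"
    by (simp add: algebra_simps)
  also have "\<dots> = x"
    by (simp add: circle)
  finally show ?thesis .
qed

lemma norm_mult_circle_le: "norm (h * x) \<le> norm x"
proof -
  have "2 * norm (h * x) = norm (unitary_op \<i> h k x + unitary_op (- \<i>) h k x)"
    by (simp add: unitary_op_add)
  also have "\<dots> \<le> norm x + norm x"
    using norm_triangle_ineq[of "unitary_op \<i> h k x" "unitary_op (- \<i>) h k x"]
    by (simp add: norm_unitary_op)
  finally show ?thesis by simp
qed

end

text \<open>\<open>k = 1 - sqrt (1 - h\<^sup>2)\<close> is the fixed point of the contraction \<open>k \<mapsto> (h\<^sup>2 + k\<^sup>2) / 2\<close>.\<close>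

lemma cstar_circle_exists:
  fixes h :: "'a::cstar_algebra"
  assumes h: "adj h = h" "norm h < 1"
  obtains k where "cstar_circle h k"
proof -
  define \<rho> where "\<rho> = (norm h)\<^sup>2"
  \<comment> \<open>The smaller root of \<rho> + R^2 = 2 R: the map \<open>f\<close> below keeps the
    ball of radius \<open>R\<close>, and \<open>R < 1\<close> is also a Lipschitz constant for it
    there.\<close>
  define R where "R = 1 - sqrt (1 - \<rho>)"
  have \<rho>: "0 \<le> \<rho>" "\<rho> < 1"
    using h(2) by (auto simp: \<rho>_def abs_square_less_1)
  have R: "0 \<le> R" "R < 1"
    using \<rho> by (auto simp: R_def)
  have R2: "\<rho> + R * R = 2 * R"
  proof -
    have "sqrt (1 - \<rho>) * sqrt (1 - \<rho>) = 1 - \<rho>" using \<rho> by simp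
    then show ?thesis by (simp add: R_def algebra_simps)
  qed
  define f where "f k = (1/2) *\<^sub>R (h * h + k * k)" for k
  \<comment> \<open>Self-adjointness and commutation with \<open>h\<close> are closed conditions
    kept by \<open>f\<close>, so the fixed point inherits them.\<close>
  define S where "S = {k. norm k \<le> R \<and> adj k = k \<and> h * k = k * h}"
  have "closed S"
  proof -
    have "closed {k::'a. adj k = k}"
    proof (rule closed_Collect_eq)
      show "continuous_on UNIV (adj :: 'a \<Rightarrow> 'a)"
        by (intro continuous_onI) (auto simp: dist_norm simp flip: adj_diff)
    qed (rule continuous_on_id)
    moreover have "closed {k. h * k = k * h}"
      by (intro closed_Collect_eq continuous_intros)
    moreover have "closed {k::'a. norm k \<le> R}"
      by (intro closed_Collect_le continuous_intros)
    ultimately show ?thesis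
      unfolding S_def by (intro closed_Collect_conj)
  qed
  then have S: "complete S" by (simp add: complete_eq_closed)
  have "0 \<in> S" using R by (simp add: S_def)
  have "f ` S \<subseteq> S"
  proof
    fix y assume "y \<in> f ` S"
    then obtain k where y: "y = f k" and k: "norm k \<le> R" "adj k = k" "h * k = k * h"
      by (auto simp: S_def)
    have "norm (h * h + k * k) \<le> norm h * norm h + norm k * norm k"
      by (meson add_mono norm_mult_ineq norm_triangle_le)
    also have "\<dots> \<le> \<rho> + R * R"
      using k R by (intro add_mono mult_mono) (auto simp: \<rho>_def power2_eq_square)
    finally have "norm y \<le> R"
      by (simp add: y f_def R2)
    moreover have "h * (h * h + k * k) = (h * h + k * k) * h"
      using k(3) by (simp add: distrib_left distrib_right mult.assoc) (simp flip: k(3) mult.assoc)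
    ultimately show "y \<in> S"
      using h k by (simp add: S_def y f_def adj_scaleR adj_add adj_mult)
  qed
  moreover have "dist (f x) (f y) \<le> R * dist x y" if "x \<in> S" "y \<in> S" for x y
  proof -
    from that
    have xy: "norm x \<le> R" "norm y \<le> R" by (auto simp: S_def)
    have "f x - f y = (1/2) *\<^sub>R (x * (x - y) + (x - y) * y)"
      by (simp add: f_def algebra_simps)
    also have "norm \<dots> \<le> (1/2) * (norm x * norm (x - y) + norm (x - y) * norm y)"
      by (simp add: norm_triangle_le norm_mult_ineq add_mono)
    also have "\<dots> \<le> (1/2) * (R * norm (x - y) + norm (x - y) * R)"
      using xy by (intro mult_left_mono add_mono mult_right_mono) auto
    finally show ?thesis
      by (simp add: dist_norm mult.commute)
  qed
  ultimately have "\<exists>!k\<in>S. f k = k"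
    using \<open>0 \<in> S\<close> by (intro Banach_fix[OF S _ R]) auto
  then obtain k where "k \<in> S" "f k = k" by blast
  moreover from \<open>f k = k\<close> have "h * h + k * k = k + k"
    unfolding f_def by (metis scaleR_half_double scaleR_2 scaleR_add_right)
  ultimately have "cstar_circle h k"
    using h by (simp add: cstar_circle_def S_def)
  then show ?thesis by (rule that)
qed

text \<open>Contractivity without spectra: a self-adjoint \<open>h\<close> of norm below 1 has a
  partner \<open>k\<close>, and the image of the pair exhibits multiplication by \<open>f h\<close>
  as half the sum of two isometries. The C*-identity reduces arbitrary elements to self-adjoint
  ones.\<close>

lemma star_automorphism_norm_le:
  assumes "star_automorphism f"
  shows "norm (f x) \<le> norm x"
proof -
  have fadd: "f (x + y) = f x + f y" and fsc: "f (scaleC c x) = scaleC c (f x)"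
    and fmul: "f (x * y) = f x * f y" and fadj: "f (adj x) = adj (f x)" for x y c
    using assms by (auto simp: star_automorphism_def)
  have *: "norm (f h) \<le> 1" if h: "adj h = h" "norm h < 1" for h
  proof -
    obtain k where "cstar_circle h k"
      using cstar_circle_exists[OF h] .
    then have "cstar_circle (f h) (f k)"
      by (simp add: cstar_circle_def flip: fadd fmul fadj)
    then have "norm (f h * x) \<le> 1 * norm x" for x
      by (simp add: cstar_circle.norm_mult_circle_le)
    then show ?thesis
      by (rule cstar_norm_le[rotated]) simp_all
  qed
  have **: "norm (f h) \<le> norm h" if h: "adj h = h" for h
  proof (rule field_le_epsilon)
    fix e :: real assume "e > 0"
    \<comment> \<open>Dividing by slightly more than the norm gives the strict inequality needed for
      a partner \<open>k\<close>.\<close>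
    define t where "t = 1 / (norm h + e)"
    have "norm h + e > 0"
      using \<open>e > 0\<close> by (simp add: add_nonneg_pos)
    then have t: "t > 0" by (simp add: t_def)
    have "norm (t *\<^sub>R h) < 1"
      using \<open>norm h + e > 0\<close> \<open>e > 0\<close> by (simp add: t_def)
    then have "norm (f (t *\<^sub>R h)) \<le> 1"
      using h by (intro *) (simp_all add: adj_scaleR)
    also have "f (t *\<^sub>R h) = t *\<^sub>R f h"
      by (metis fsc scaleC_of_real)
    finally show "norm (f h) \<le> norm h + e"
      using \<open>norm h + e > 0\<close> by (simp add: t_def field_simps)
  qed
  have "(norm (f x))\<^sup>2 = norm (f (adj x * x))"
    by (simp add: fmul fadj cstar_identity)
  also have "\<dots> \<le> norm (adj x * x)"
    by (intro **) (simp add: adj_mult adj_adj)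
  also have "\<dots> = (norm x)\<^sup>2"
    by (simp add: cstar_identity)
  finally show ?thesis
    by (rule power2_le_imp_le) simp
qed

section \<open>The norm of a polynomial in a self-adjoint contraction\<close>

text \<open>Left multiplication by p(h). Acting on an element \<open>x\<close> gives a meaning to
  the constant term when there is no unit.\<close>

definition poly_op :: "'a::cstar_algebra \<Rightarrow> real poly \<Rightarrow> 'a \<Rightarrow> 'a" where
  "poly_op h p x = fold_coeffs (\<lambda>c y. c *\<^sub>R x + h * y) p 0"

lemma poly_op_0 [simp]: "poly_op h 0 x = 0"
  by (simp add: poly_op_def)

lemma poly_op_pCons [simp]: "poly_op h (pCons c p) x = c *\<^sub>R x + h * poly_op h p x"
  by (cases "p = 0 \<and> c = 0") (auto simp: poly_op_def)

lemma poly_op_1 [simp]: "poly_op h 1 x = x"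
  by (simp add: one_pCons)

lemma poly_op_add: "poly_op h (p + q) x = poly_op h p x + poly_op h q x"
  by (induction p q rule: poly_induct2) (auto simp: algebra_simps)

lemma poly_op_smult: "poly_op h (Polynomial.smult c p) x = c *\<^sub>R poly_op h p x"
  by (induction p) (auto simp: algebra_simps)

lemma poly_op_minus: "poly_op h (- p) x = - poly_op h p x"
  using poly_op_smult[of h "-1" p x] by simp

lemma poly_op_diff: "poly_op h (p - q) x = poly_op h p x - poly_op h q x"
  using poly_op_add[of h p "- q" x] by (simp add: poly_op_minus)

lemma poly_op_sum: "poly_op h (\<Sum>i\<in>I. p i) x = (\<Sum>i\<in>I. poly_op h (p i) x)"
  by (induction I rule: infinite_finite_induct) (auto simp: poly_op_add)

lemma poly_op_add_right: "poly_op h p (x + y) = poly_op h p x + poly_op h p y"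
  by (induction p) (auto simp: algebra_simps)

lemma poly_op_scaleR_right: "poly_op h p (c *\<^sub>R x) = c *\<^sub>R poly_op h p x"
  by (induction p) (auto simp: algebra_simps)

lemma poly_op_diff_right: "poly_op h p (x - y) = poly_op h p x - poly_op h p y"
  using poly_op_add_right[of h p "x - y" y] by simp

lemma poly_op_mult_right: "poly_op h p (x * y) = poly_op h p x * y"
  by (induction p) (auto simp: algebra_simps)

lemma poly_op_commute: "poly_op h p (h * x) = h * poly_op h p x"
  by (induction p) (auto simp: algebra_simps)

lemma poly_op_mult: "poly_op h (p * q) x = poly_op h p (poly_op h q x)"
  by (induction p) (auto simp: mult_pCons_left poly_op_add poly_op_smult)

text \<open>With \<open>adj x * y\<close> as an algebra valued inner product, p(h) is a symmetric
  operator because its coefficients are real. This replaces a representation on a Hilbert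
  space.\<close>

lemma poly_op_adj:
  assumes "adj h = h"
  shows "adj (poly_op h p x) * y = adj x * poly_op h p y"
proof (induction p arbitrary: y)
  case (pCons c p)
  have "adj (poly_op h p x) * h * y = adj x * poly_op h p (h * y)"
    using pCons.IH[of "h * y"] by (simp add: mult.assoc)
  then show ?case
    by (simp add: adj_add adj_scaleR adj_mult assms distrib_left distrib_right poly_op_commute)
qed simp

section \<open>Chebyshev polynomials of the first kind\<close>

fun cheb :: "nat \<Rightarrow> real poly" where
  "cheb 0 = 1"
| "cheb (Suc 0) = [:0, 1:]"
| "cheb (Suc (Suc n)) = [:0, 2:] * cheb (Suc n) - cheb n"

lemma poly_cheb_cos: "poly (cheb n) (cos t) = cos (real n * t)"
proof (induction n rule: cheb.induct)
  case (3 n)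
  have "cos (real (Suc (Suc n)) * t) + cos (real n * t)
      = 2 * cos t * cos (real (Suc n) * t)"
    using cos_add[of "real (Suc n) * t" t] cos_diff[of "real (Suc n) * t" t]
    by (simp add: algebra_simps)
  with 3 show ?case by simp
qed auto

lemma cheb_shift: "[:0, 1:] * cheb (Suc n) = Polynomial.smult (1/2) (cheb (Suc (Suc n)) + cheb n)"
  by simp

lemma smult_sum_right:
  "Polynomial.smult c (\<Sum>i\<in>I. f i) = (\<Sum>i\<in>I. Polynomial.smult c (f i))"
  by (induction I rule: infinite_finite_induct) (auto simp: smult_add_right)

text \<open>Writing \<open>p\<close> as c + X q, the induction needs only that multiplication by X
  raises the Chebyshev index by at most one; above index 0 this is
  \<open>cheb_shift\<close>.\<close>

lemma cheb_expansion:
  assumes "degree p \<le> d"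
  shows "\<exists>a. p = (\<Sum>j\<le>d. Polynomial.smult (a j) (cheb j))"
  using assms
proof (induction d arbitrary: p)
  case 0
  then obtain c where "p = [:c:]" by (metis degree_0_id le_zero_eq)
  then show ?case by (intro exI[of _ "\<lambda>_. c"]) simp
next
  case (Suc d)
  define S where "S = range (\<lambda>a. \<Sum>j\<le>Suc d. Polynomial.smult (a j) (cheb j))"
  have S_I: "(\<Sum>j\<le>Suc d. Polynomial.smult (a j) (cheb j)) \<in> S" for a
    unfolding S_def by (rule image_eqI[where x = a]) (rule refl, rule UNIV_I)
  have add: "p + q \<in> S" if "p \<in> S" "q \<in> S" for p q
  proof -
    from that obtain a b where "p = (\<Sum>j\<le>Suc d. Polynomial.smult (a j) (cheb j))" "q = (\<Sum>j\<le>Suc d. Polynomial.smult (b j) (cheb j))"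
      unfolding S_def by blast
    then have "p + q = (\<Sum>j\<le>Suc d. Polynomial.smult (a j + b j) (cheb j))"
      by (simp only: smult_add_left sum.distrib)
    then show ?thesis using S_I[of "\<lambda>j. a j + b j"] by (simp only:)
  qed
  have smult: "Polynomial.smult c p \<in> S" if "p \<in> S" for c p
  proof -
    from that obtain a where "p = (\<Sum>j\<le>Suc d. Polynomial.smult (a j) (cheb j))"
      unfolding S_def by blast
    then have "Polynomial.smult c p = (\<Sum>j\<le>Suc d. Polynomial.smult (c * a j) (cheb j))"
      by (simp only: smult_sum_right smult_smult)
    then show ?thesis using S_I[of "\<lambda>j. c * a j"] by (simp only:)
  qed
  have cheb: "cheb j \<in> S" if "j \<le> Suc d" for j
  proof -
    have "cheb j = (\<Sum>i\<le>Suc d. Polynomial.smult (if i = j then 1 else 0) (cheb i))"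
      using that by (simp add: if_distrib[of "\<lambda>c. Polynomial.smult c _"] sum.delta' cong: if_cong del: sum.atMost_Suc)
    then show ?thesis using S_I[of "\<lambda>i. if i = j then 1 else 0"] by (simp only:)
  qed
  have sum: "(\<Sum>i\<in>I. f i) \<in> S" if "\<And>i. i \<in> I \<Longrightarrow> f i \<in> S" "finite I" for f and I :: "nat set"
    using that(2,1)
  proof (induction I rule: finite_induct)
    case empty
    show ?case using smult[OF cheb[of 0], of 0] by simp
  qed (auto intro: add)
  have X: "[:0, 1:] * cheb j \<in> S" if "j \<le> d" for j
  proof (cases j)
    case 0
    then show ?thesis using cheb[of 1] by simp
  next
    case (Suc n)
    then show ?thesis
      using that by (simp only: cheb_shift) (intro smult add cheb; simp)
  qed
  obtain c q where p: "p = pCons c q" by (cases p)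
  with Suc.prems have "degree q \<le> d" by (auto split: if_splits)
  then obtain a where q: "q = (\<Sum>j\<le>d. Polynomial.smult (a j) (cheb j))"
    using Suc.IH by blast
  have "p = Polynomial.smult c (cheb 0) + [:0, 1:] * q"
    by (simp add: p one_pCons)
  also have "\<dots> = Polynomial.smult c (cheb 0) + (\<Sum>j\<le>d. Polynomial.smult (a j) ([:0, 1:] * cheb j))"
    by (simp only: q sum_distrib_left mult_smult_right)
  also have "\<dots> \<in> S"
    by (intro add sum smult X cheb) auto
  finally show ?case unfolding S_def by blast
qed

lemma cos_int_has_integral:
  "((\<lambda>t. cos (of_int m * t)) has_integral (if m = 0 then 2 * pi else 0)) {0..2 * pi}"
proof (cases "m = 0")
  case True
  then show ?thesis
    using has_integral_const_real[of "1::real" 0 "2 * pi"] by simp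
next
  case False
  have "((\<lambda>t. cos (of_int m * t)) has_integral
      (sin (of_int m * (2 * pi)) / of_int m - sin (of_int m * 0) / of_int m)) {0..2 * pi}"
    using False
    by (intro fundamental_theorem_of_calculus)
      (auto intro!: derivative_eq_intros simp flip: has_real_derivative_iff_has_vector_derivative)
  moreover have "sin (of_int m * (2 * pi)) = 0"
    using sin_int_2pin[of m] by (simp add: mult.commute)
  ultimately show ?thesis using False by simp
qed

text \<open>In the variable cos t the \<open>a j\<close> are the cosine coefficients of a
  trigonometric polynomial, and orthogonality over a full period isolates \<open>a k\<close>. The
  factor 2 appears because cos^2 has mean 1/2 when \<open>k > 0\<close>.\<close>

lemma cheb_coeff_bound:
  assumes p: "p = (\<Sum>j\<le>d. Polynomial.smult (a j) (cheb j))"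
    and M: "\<And>t. \<lbrakk>-1 \<le> t; t \<le> 1\<rbrakk> \<Longrightarrow> \<bar>poly p t\<bar> \<le> M" and k: "k \<le> d"
  shows "\<bar>a k\<bar> \<le> 2 * M"
proof -
  have "0 \<le> M" using M[of 0] by simp
  define c where "c j = (if j = k then if k = 0 then 2 * pi else pi else (0::real))" for j :: nat
  have *: "((\<lambda>t. cos (real j * t) * cos (real k * t)) has_integral c j) {0..2 * pi}" for j
  proof -
    have "(\<lambda>t. cos (real j * t) * cos (real k * t))
        = (\<lambda>t. (cos (of_int (int j - int k) * t) + cos (of_int (int j + int k) * t)) / 2)"
      by (simp add: cos_times_cos algebra_simps)
    moreover have "((\<lambda>t. (cos (of_int (int j - int k) * t) + cos (of_int (int j + int k) * t)) / 2)
        has_integral ((if int j - int k = 0 then 2 * pi else 0) + (if int j + int k = 0 then 2 * pi else 0)) / 2) {0..2 * pi}"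
      by (intro has_integral_divide has_integral_add cos_int_has_integral)
    moreover have "((if int j - int k = 0 then 2 * pi else 0) + (if int j + int k = 0 then 2 * pi else 0)) / 2 = c j"
      by (auto simp: c_def)
    ultimately show ?thesis by (simp only:)
  qed
  have "((\<lambda>t. \<Sum>j\<le>d. a j * (cos (real j * t) * cos (real k * t))) has_integral (\<Sum>j\<le>d. a j * c j)) {0..2 * pi}"
    by (intro has_integral_sum has_integral_mult_right *) auto
  moreover have "(\<Sum>j\<le>d. a j * (cos (real j * t) * cos (real k * t))) = poly p (cos t) * cos (real k * t)" for t
    by (simp add: p poly_sum poly_cheb_cos sum_distrib_right mult.assoc)
  moreover have "(\<Sum>j\<le>d. a j * c j) = a k * c k"
    using k by (subst sum.mono_neutral_right[of _ "{k}"]) (auto simp: c_def)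
  ultimately have int: "((\<lambda>t. poly p (cos t) * cos (real k * t)) has_integral a k * c k) {0..2 * pi}"
    by simp
  have "\<bar>poly p (cos t) * cos (real k * t)\<bar> \<le> M * 1" for t
    unfolding abs_mult using \<open>0 \<le> M\<close> by (intro mult_mono M) auto
  then have "\<bar>a k * c k\<bar> \<le> M * (2 * pi)"
    using has_integral_bound_real[OF \<open>0 \<le> M\<close> _ int, of "{}"] by auto
  moreover have "pi \<le> c k" by (auto simp: c_def)
  then have "\<bar>a k\<bar> * pi \<le> \<bar>a k * c k\<bar>"
    by (simp add: abs_mult mult_left_mono)
  ultimately have "\<bar>a k\<bar> * pi \<le> (2 * M) * pi" by linarith
  then show ?thesis by simp
qed

context cstar_circle begin

text \<open>As \<open>h\<close> is half the sum of a unitary and its inverse, the sum of their n-th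
  powers obeys the recursion that defines \<open>cheb\<close>.\<close>

lemma poly_op_cheb:
  "2 *\<^sub>R poly_op h (cheb n) x = (unitary_op \<i> h k ^^ n) x + (unitary_op (- \<i>) h k ^^ n) x"
proof (induction n rule: cheb.induct)
  case (2)
  show ?case using unitary_op_add[of x] by simp
next
  case (3 n)
  let ?u = "unitary_op \<i> h k" and ?v = "unitary_op (- \<i>) h k"
  have u: "2 *\<^sub>R (h * (?u ^^ Suc n) x) = (?u ^^ Suc (Suc n)) x + (?u ^^ n) x"
    using unitary_op_add[of "(?u ^^ Suc n) x"] unitary_op_inverse[of \<i> "(?u ^^ n) x"] by simp
  have v: "2 *\<^sub>R (h * (?v ^^ Suc n) x) = (?v ^^ n) x + (?v ^^ Suc (Suc n)) x"
    using unitary_op_add[of "(?v ^^ Suc n) x"] unitary_op_inverse[of "- \<i>" "(?v ^^ n) x"] by simp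
  have "2 *\<^sub>R poly_op h (cheb (Suc (Suc n))) x
      = 2 *\<^sub>R (h * (2 *\<^sub>R poly_op h (cheb (Suc n)) x)) - 2 *\<^sub>R poly_op h (cheb n) x"
    by (simp add: poly_op_diff poly_op_smult scaleR_diff_right)
  also have "\<dots> = 2 *\<^sub>R (h * (?u ^^ Suc n) x) + 2 *\<^sub>R (h * (?v ^^ Suc n) x) - ((?u ^^ n) x + (?v ^^ n) x)"
    unfolding 3 by (simp only: distrib_left scaleR_add_right)
  also have "\<dots> = (?u ^^ Suc (Suc n)) x + (?v ^^ Suc (Suc n)) x"
    unfolding u v by simp
  finally show ?case .
qed (simp add: scaleR_2)

lemma norm_poly_op_cheb: "norm (poly_op h (cheb n) x) \<le> norm x"
proof -
  have "norm ((unitary_op c h k ^^ n) x) = norm x" if "c = \<i> \<or> c = - \<i>" for c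
    by (induction n) (simp_all add: norm_unitary_op[OF that])
  then have "norm (2 *\<^sub>R poly_op h (cheb n) x) \<le> norm x + norm x"
    unfolding poly_op_cheb by (metis norm_triangle_ineq)
  then show ?thesis by simp
qed

lemma norm_poly_op_crude:
  assumes M: "\<And>t. \<lbrakk>-1 \<le> t; t \<le> 1\<rbrakk> \<Longrightarrow> \<bar>poly p t\<bar> \<le> M" and "degree p \<le> d"
  shows "norm (poly_op h p x) \<le> 2 * (real d + 1) * M * norm x"
proof -
  obtain a where a: "p = (\<Sum>j\<le>d. Polynomial.smult (a j) (cheb j))"
    using cheb_expansion[OF assms(2)] by blast
  have "norm (poly_op h p x) \<le> (\<Sum>j\<le>d. norm (a j *\<^sub>R poly_op h (cheb j) x))"
    unfolding a poly_op_sum poly_op_smult by (rule norm_sum)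
  also have "\<dots> \<le> (\<Sum>j\<le>d. 2 * M * norm x)"
  proof (rule sum_mono)
    fix j assume "j \<in> {..d}"
    then have "\<bar>a j\<bar> \<le> 2 * M"
      using cheb_coeff_bound[OF a M] by auto
    then show "norm (a j *\<^sub>R poly_op h (cheb j) x) \<le> 2 * M * norm x"
      unfolding norm_scaleR by (intro mult_mono norm_poly_op_cheb) auto
  qed
  also have "\<dots> = 2 * (real d + 1) * M * norm x"
    by (simp add: algebra_simps)
  finally show ?thesis .
qed

end

lemma norm_poly_op_power:
  assumes h: "adj h = h" and "x \<noteq> 0"
  shows "(norm (poly_op h p x) / norm x) ^ (2 ^ k) \<le> norm (poly_op h (p ^ (2 ^ k)) x) / norm x"
proof (induction k)
  case (Suc k)
  let ?q = "p ^ (2 ^ k)"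
  have "(norm (poly_op h ?q x))\<^sup>2 = norm (adj x * poly_op h (?q * ?q) x)"
    by (simp add: poly_op_mult poly_op_adj[OF h] flip: cstar_identity)
  also have "\<dots> \<le> norm x * norm (poly_op h (?q * ?q) x)"
    using norm_mult_ineq[of "adj x" "poly_op h (?q * ?q) x"] by simp
  finally have *: "(norm (poly_op h ?q x) / norm x)\<^sup>2 \<le> norm (poly_op h (?q * ?q) x) / norm x"
    using assms by (simp add: power_divide divide_simps power2_eq_square mult.commute)
  have "(norm (poly_op h p x) / norm x) ^ (2 ^ Suc k) = ((norm (poly_op h p x) / norm x) ^ (2 ^ k))\<^sup>2"
    by (simp add: mult.commute flip: power_mult)
  also have "\<dots> \<le> (norm (poly_op h ?q x) / norm x)\<^sup>2"
    using Suc by (intro power_mono) auto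
  also note *
  also have "?q * ?q = p ^ (2 ^ Suc k)"
    by (simp add: mult_2 power_add)
  finally show ?case .
qed simp

text \<open>Since \<open>\<parallel>p(h) x\<parallel>\<^sup>2 \<le> \<parallel>x\<parallel> \<parallel>p\<^sup>2(h) x\<parallel>\<close>, a bound by the supremum norm that grows
  linearly in the degree improves to the sharp bound by passing to the powers \<open>p ^ 2 ^ k\<close>.\<close>

lemma norm_poly_op_le_strict:
  fixes h x :: "'a::cstar_algebra"
  assumes h: "adj h = h" "norm h < 1"
    and M: "\<And>t. \<lbrakk>-1 \<le> t; t \<le> 1\<rbrakk> \<Longrightarrow> \<bar>poly p t\<bar> \<le> M" and "M > 0"
  shows "norm (poly_op h p x) \<le> M * norm x"
proof (cases "x = 0")
  case True
  then show ?thesis using poly_op_scaleR_right[of h p 0 x] by simp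
next
  case False
  obtain k where "cstar_circle h k"
    using cstar_circle_exists[OF h] .
  then interpret cstar_circle h k .
  define d where "d = real (degree p)"
  define r where "r = norm (poly_op h p x) / norm x / M"
  have bound: "r ^ (2 ^ k) \<le> 2 * (d * real (2 ^ k) + 1)" for k
  proof -
    have "norm (poly_op h (p ^ (2 ^ k)) x) \<le> 2 * (real (degree p * 2 ^ k) + 1) * M ^ (2 ^ k) * norm x"
      using M by (intro norm_poly_op_crude) (auto simp: poly_power power_abs degree_power_le intro!: power_mono)
    then have "norm (poly_op h (p ^ (2 ^ k)) x) / norm x \<le> 2 * (d * real (2 ^ k) + 1) * M ^ (2 ^ k)"
      using False by (simp add: divide_simps d_def)
    with norm_poly_op_power[OF h(1) False, of p k]
    have "(norm (poly_op h p x) / norm x) ^ (2 ^ k) \<le> 2 * (d * real (2 ^ k) + 1) * M ^ (2 ^ k)"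
      by linarith
    then show ?thesis
      using \<open>M > 0\<close> unfolding r_def power_divide[of _ M] by (simp add: pos_divide_le_eq)
  qed
  \<comment> \<open>Powers of a ratio above 1 would outgrow the linear right-hand side of
    \<open>bound\<close>.\<close>
  have "r \<le> 1"
  proof (rule ccontr)
    assume "\<not> r \<le> 1"
    then have "eventually (\<lambda>n::nat. 2 * (d * real n + 1) < r ^ n) at_top"
      by real_asymp
    then obtain N where "2 * (d * real n + 1) < r ^ n" if "n \<ge> N" for n
      by (auto simp: eventually_at_top_linorder)
    then have "2 * (d * real (2 ^ N) + 1) < r ^ (2 ^ N)"
      by (meson less_exp less_imp_le)
    with bound[of N] show False by linarith
  qed
  then show ?thesis
    using \<open>M > 0\<close> False by (simp add: r_def divide_simps mult.commute)
qed

lemma norm_poly_op_le: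
  fixes h x :: "'a::cstar_algebra"
  assumes h: "adj h = h" "norm h \<le> 1"
    and M: "\<And>t. \<lbrakk>-1 \<le> t; t \<le> 1\<rbrakk> \<Longrightarrow> \<bar>poly p t\<bar> \<le> M"
  shows "norm (poly_op h p x) \<le> M * norm x"
proof -
  have "M \<ge> 0" using M[of 0] by simp
  define s where "s n = 1 - 1 / real (Suc n)" for n
  have s: "s \<longlonglongrightarrow> 1" unfolding s_def by real_asymp
  have lim: "(\<lambda>n. poly_op (s n *\<^sub>R h) p x) \<longlonglongrightarrow> poly_op h p x"
  proof (induction p)
    case (pCons c p)
    have "(\<lambda>n. c *\<^sub>R x + s n *\<^sub>R h * poly_op (s n *\<^sub>R h) p x) \<longlonglongrightarrow> c *\<^sub>R x + 1 *\<^sub>R h * poly_op h p x"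
      by (intro tendsto_intros s pCons.IH)
    then show ?case by simp
  qed simp
  \<comment> \<open>\<open>M\<close> may be 0, whereas the bound for strict contractions asks for a
    positive constant.\<close>
  have "norm (poly_op h p x) \<le> (M + \<delta>) * norm x" if "\<delta> > 0" for \<delta>
  proof (rule LIMSEQ_le_const2[OF tendsto_norm[OF lim]], intro exI allI impI)
    fix n
    have s01: "0 \<le> s n" "s n < 1" by (auto simp: s_def)
    have "s n * norm h \<le> s n * 1"
      using s01 h by (intro mult_left_mono) auto
    then have "norm (s n *\<^sub>R h) < 1" using s01 by simp
    moreover have "\<bar>poly p t\<bar> \<le> M + \<delta>" if "-1 \<le> t" "t \<le> 1" for t
      using M[OF that] \<open>\<delta> > 0\<close> by linarith
    ultimately show "norm (poly_op (s n *\<^sub>R h) p x) \<le> (M + \<delta>) * norm x"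
      using h that \<open>M \<ge> 0\<close> by (intro norm_poly_op_le_strict) (simp_all add: adj_scaleR)
  qed
  then have *: "norm (poly_op h p x) \<le> M * norm x + \<delta> * norm x" if "\<delta> > 0" for \<delta>
    using that by (simp add: distrib_right)
  show ?thesis
  proof (rule field_le_epsilon)
    fix e :: real assume "e > 0"
    define \<delta> where "\<delta> = e / (norm x + 1)"
    have "\<delta> > 0" using \<open>e > 0\<close> by (simp add: \<delta>_def add_nonneg_pos)
    moreover have "\<delta> * norm x \<le> e"
      using \<open>e > 0\<close> by (simp add: \<delta>_def pos_divide_le_eq add_nonneg_pos)
    ultimately show "norm (poly_op h p x) \<le> M * norm x + e"
      using *[of \<delta>] by linarith
  qed
qed

section \<open>Continuous functional calculus\<close>

definition sa_contraction :: "'a::cstar_algebra \<Rightarrow> bool" where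
  "sa_contraction h \<longleftrightarrow> adj h = h \<and> norm h \<le> 1"

lemma sa_contractionD: "sa_contraction h \<Longrightarrow> adj h = h" "sa_contraction h \<Longrightarrow> norm h \<le> 1"
  by (simp_all add: sa_contraction_def)

lemma real_poly_approx:
  fixes f :: "real \<Rightarrow> real"
  assumes "continuous_on {-1..1} f" "0 < e"
  obtains p where "\<And>t. t \<in> {-1..1} \<Longrightarrow> \<bar>f t - poly p t\<bar> \<le> e"
proof -
  obtain g where g: "real_polynomial_function g" "\<And>t. t \<in> {-1..1} \<Longrightarrow> \<bar>f t - g t\<bar> < e"
    using Stone_Weierstrass_real_polynomial_function[OF compact_Icc assms] by blast
  then obtain a n where "g = (\<lambda>x. \<Sum>i\<le>n. a i * x ^ i)"
    using real_polynomial_function_iff_sum by blast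
  then have "g t = poly (\<Sum>i\<le>n. monom (a i) i) t" for t
    by (simp add: poly_sum poly_monom)
  with g(2) show ?thesis by (metis that less_imp_le)
qed

text \<open>An arbitrary fixed choice, independent of \<open>h\<close>. By
  \<open>cfc_poly_op_dist\<close>, for continuous \<open>f\<close> and self-adjoint contractions the
  value of \<open>cfc\<close> does not depend on it.\<close>

definition poly_approx :: "(real \<Rightarrow> real) \<Rightarrow> nat \<Rightarrow> real poly" where
  "poly_approx f n = (SOME p. \<forall>t\<in>{-1..1}. \<bar>f t - poly p t\<bar> \<le> 1 / real (Suc n))"

text \<open>As there is no unit at hand, \<open>f(h)\<close> is realised as the operator \<open>cfc h f\<close> of left
  multiplication; in general it is an element of the algebra only if \<open>f 0 = 0\<close>.\<close>

definition cfc :: "'a::cstar_algebra \<Rightarrow> (real \<Rightarrow> real) \<Rightarrow> 'a \<Rightarrow> 'a" where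
  "cfc h f x = lim (\<lambda>n. poly_op h (poly_approx f n) x)"

lemma poly_approx:
  assumes "continuous_on {-1..1} f" "t \<in> {-1..1}"
  shows "\<bar>f t - poly (poly_approx f n) t\<bar> \<le> 1 / real (Suc n)"
proof -
  have "\<exists>p. \<forall>t\<in>{-1..1}. \<bar>f t - poly p t\<bar> \<le> 1 / real (Suc n)"
    using real_poly_approx[OF assms(1), of "1 / real (Suc n)"] by (metis of_nat_0_less_iff zero_less_Suc zero_less_divide_1_iff)
  from someI_ex[OF this] show ?thesis
    using assms(2) by (simp add: poly_approx_def)
qed

lemma norm_poly_op_diff_le:
  assumes "sa_contraction h" "\<And>t. t \<in> {-1..1} \<Longrightarrow> \<bar>poly p t - poly q t\<bar> \<le> M"
  shows "norm (poly_op h p x - poly_op h q x) \<le> M * norm x"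
  using assms unfolding poly_op_diff[symmetric]
  by (intro norm_poly_op_le) (auto simp: sa_contraction_def)

text \<open>The sup norm bound makes the defining sequence Cauchy, and the comparison with
  \<open>p\<close> survives in the limit. Everything later about \<open>cfc\<close> rests on this
  estimate and not on the definition.\<close>

lemma cfc_poly_op_dist:
  fixes h x :: "'a::cstar_algebra"
  assumes h: "sa_contraction h" and f: "continuous_on {-1..1} f"
    and p: "\<And>t. t \<in> {-1..1} \<Longrightarrow> \<bar>f t - poly p t\<bar> \<le> e"
  shows "norm (cfc h f x - poly_op h p x) \<le> e * norm x"
proof -
  let ?q = "poly_approx f"
  have pq: "norm (poly_op h (?q n) x - poly_op h p x) \<le> (1 / real (Suc n) + e) * norm x"
    if "\<And>t. t \<in> {-1..1} \<Longrightarrow> \<bar>f t - poly p t\<bar> \<le> e" for n p e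
  proof (rule norm_poly_op_diff_le[OF h])
    fix t :: real assume t: "t \<in> {-1..1}"
    show "\<bar>poly (?q n) t - poly p t\<bar> \<le> 1 / real (Suc n) + e"
      using poly_approx[OF f t, of n] that[OF t] by linarith
  qed
  have "Cauchy (\<lambda>n. poly_op h (?q n) x)"
  proof (rule CauchyI)
    fix \<epsilon> :: real assume "\<epsilon> > 0"
    then have "\<epsilon> / (2 * (norm x + 1)) > 0" by (simp add: add_nonneg_pos)
    then obtain N where N: "1 / real (Suc N) < \<epsilon> / (2 * (norm x + 1))"
      using nat_approx_posE by blast
    show "\<exists>M. \<forall>m\<ge>M. \<forall>n\<ge>M. norm (poly_op h (?q m) x - poly_op h (?q n) x) < \<epsilon>"
    proof (intro exI allI impI)
      fix m n assume "N \<le> m" "N \<le> n"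
      then have "1 / real (Suc m) \<le> 1 / real (Suc N)" "1 / real (Suc n) \<le> 1 / real (Suc N)"
        by (simp_all add: frac_le)
      then have "(1 / real (Suc m) + 1 / real (Suc n)) * norm x \<le> 2 * (1 / real (Suc N)) * norm x"
        by (intro mult_right_mono) auto
      also have "\<dots> \<le> 2 * (1 / real (Suc N)) * (norm x + 1)"
        by (intro mult_left_mono) auto
      also have "\<dots> < \<epsilon>"
        using N by (simp add: pos_less_divide_eq add_nonneg_pos mult_ac)
      finally show "norm (poly_op h (?q m) x - poly_op h (?q n) x) < \<epsilon>"
        using pq[OF poly_approx[OF f], of m n] by linarith
    qed
  qed
  then have "(\<lambda>n. poly_op h (?q n) x) \<longlonglongrightarrow> cfc h f x"
    unfolding cfc_def by (simp add: Cauchy_convergent_iff convergent_LIMSEQ_iff)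
  then have 1: "(\<lambda>n. norm (poly_op h (?q n) x - poly_op h p x)) \<longlonglongrightarrow> norm (cfc h f x - poly_op h p x)"
    by (intro tendsto_intros)
  have "(\<lambda>n. 1 / real (Suc n)) \<longlonglongrightarrow> 0" by real_asymp
  then have 2: "(\<lambda>n. (1 / real (Suc n) + e) * norm x) \<longlonglongrightarrow> (0 + e) * norm x"
    by (intro tendsto_intros)
  show ?thesis
    using LIMSEQ_le[OF 1 2] pq[OF p] by auto
qed

text \<open>The restriction \<open>e \<le> 1\<close> lets squares of \<open>e\<close> be absorbed
  into the constant, as products require.\<close>

lemma real_le_of_scaled_epsilon:
  fixes a b C :: real
  assumes "\<And>e. \<lbrakk>0 < e; e \<le> 1\<rbrakk> \<Longrightarrow> a \<le> b + C * e"
  shows "a \<le> b"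
proof (rule field_le_epsilon)
  fix e :: real assume "e > 0"
  define d where "d = min 1 (e / (\<bar>C\<bar> + 1))"
  have d: "0 < d" "d \<le> 1" using \<open>e > 0\<close> by (auto simp: d_def)
  have "C * d \<le> (\<bar>C\<bar> + 1) * d"
    using d by (intro mult_right_mono) auto
  also have "\<dots> \<le> (\<bar>C\<bar> + 1) * (e / (\<bar>C\<bar> + 1))"
    by (intro mult_left_mono) (auto simp: d_def)
  also have "\<dots> = e" by simp
  finally show "a \<le> b + e" using assms[OF d] by linarith
qed

text \<open>Identities for \<open>cfc\<close> thereby reduce to polynomials, up to errors linear in
  \<open>e\<close>.\<close>

lemma cfc_eqI:
  fixes h x y :: "'a::cstar_algebra"
  assumes h: "sa_contraction h" and f: "continuous_on {-1..1} f"
    and *: "\<And>e. \<lbrakk>0 < e; e \<le> 1\<rbrakk> \<Longrightarrow> \<exists>p. (\<forall>t\<in>{-1..1}. \<bar>f t - poly p t\<bar> \<le> C * e) \<and> norm (y - poly_op h p x) \<le> D * e"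
  shows "y = cfc h f x"
proof -
  have "norm (y - cfc h f x) \<le> 0 + (C * norm x + D) * e" if e: "0 < e" "e \<le> 1" for e
  proof -
    obtain p where p: "\<And>t. t\<in>{-1..1} \<Longrightarrow> \<bar>f t - poly p t\<bar> \<le> C * e" "norm (y - poly_op h p x) \<le> D * e"
      using *[OF e] by blast
    have "norm (cfc h f x - poly_op h p x) \<le> C * e * norm x"
      using p by (intro cfc_poly_op_dist[OF h f]) auto
    moreover have "norm (y - cfc h f x) \<le> norm (y - poly_op h p x) + norm (cfc h f x - poly_op h p x)"
      using norm_triangle_ineq4[of "y - poly_op h p x" "cfc h f x - poly_op h p x"] by simp
    ultimately show ?thesis using p(2) by (simp add: algebra_simps)
  qed
  then have "norm (y - cfc h f x) \<le> 0" by (rule real_le_of_scaled_epsilon)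
  then show ?thesis by simp
qed

lemma cfc_poly:
  assumes "sa_contraction h" "\<And>t. t \<in> {-1..1} \<Longrightarrow> f t = poly p t"
  shows "cfc h f x = poly_op h p x"
proof -
  have "continuous_on {-1..1} f"
    using assms(2) by (subst continuous_on_cong[OF refl assms(2)]) (auto intro: continuous_intros)
  from cfc_poly_op_dist[OF assms(1) this, of p 0 x] show ?thesis
    using assms(2) by simp
qed

lemma cfc_diff_bound:
  fixes h x :: "'a::cstar_algebra"
  assumes h: "sa_contraction h" and f: "continuous_on {-1..1} f" and g: "continuous_on {-1..1} g"
    and M: "\<And>t. t \<in> {-1..1} \<Longrightarrow> \<bar>f t - g t\<bar> \<le> M"
  shows "norm (cfc h f x - cfc h g x) \<le> M * norm x"
proof -
  have "norm (cfc h f x - cfc h g x) \<le> M * norm x + (4 * norm x) * e" if "0 < e" "e \<le> 1" for e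
  proof -
    obtain p q where p: "\<And>t. t \<in> {-1..1} \<Longrightarrow> \<bar>f t - poly p t\<bar> \<le> e"
      and q: "\<And>t. t \<in> {-1..1} \<Longrightarrow> \<bar>g t - poly q t\<bar> \<le> e"
      using real_poly_approx[OF f \<open>0 < e\<close>] real_poly_approx[OF g \<open>0 < e\<close>] by metis
    have "norm (poly_op h p x - poly_op h q x) \<le> (M + 2 * e) * norm x"
    proof (rule norm_poly_op_diff_le[OF h])
      fix t :: real assume t: "t \<in> {-1..1}"
      show "\<bar>poly p t - poly q t\<bar> \<le> M + 2 * e"
        using p[OF t] q[OF t] M[OF t] by linarith
    qed
    moreover have "norm (cfc h f x - poly_op h p x) \<le> e * norm x"
      by (rule cfc_poly_op_dist[OF h f p])
    moreover have "norm (cfc h g x - poly_op h q x) \<le> e * norm x"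
      by (rule cfc_poly_op_dist[OF h g q])
    moreover have "norm (cfc h f x - cfc h g x) \<le> norm (cfc h f x - poly_op h p x) + norm (poly_op h p x - poly_op h q x) + norm (cfc h g x - poly_op h q x)"
      using norm_triangle_ineq4[of "cfc h f x - poly_op h q x" "cfc h g x - poly_op h q x"]
        norm_triangle_ineq[of "cfc h f x - poly_op h p x" "poly_op h p x - poly_op h q x"] by simp
    ultimately show ?thesis by (simp add: algebra_simps)
  qed
  then show ?thesis by (rule real_le_of_scaled_epsilon)
qed

lemma cfc_bound:
  assumes "sa_contraction h" "continuous_on {-1..1} f"
    and "\<And>t. t \<in> {-1..1} \<Longrightarrow> \<bar>f t\<bar> \<le> M"
  shows "norm (cfc h f x) \<le> M * norm x"
  using cfc_diff_bound[OF assms(1,2), of "\<lambda>_. 0" M x] cfc_poly[OF assms(1), of "\<lambda>_. 0" 0 x] assms(3)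
  by simp

lemma continuous_on_Icc_bounded:
  fixes f :: "real \<Rightarrow> real"
  assumes "continuous_on {-1..1} f"
  obtains M where "0 \<le> M" "\<And>t. t \<in> {-1..1} \<Longrightarrow> \<bar>f t\<bar> \<le> M"
proof -
  have "bounded (f ` {-1..1})"
    using assms compact_Icc compact_continuous_image compact_imp_bounded by blast
  then show ?thesis
    using that unfolding bounded_pos by (metis image_eqI less_imp_le real_norm_def)
qed

lemma cfc_mult:
  fixes h x :: "'a::cstar_algebra"
  assumes h: "sa_contraction h" and f: "continuous_on {-1..1} f" and g: "continuous_on {-1..1} g"
  shows "cfc h f (cfc h g x) = cfc h (\<lambda>t. f t * g t) x"
proof -
  obtain A where A: "0 \<le> A" "\<And>t. t \<in> {-1..1} \<Longrightarrow> \<bar>f t\<bar> \<le> A"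
    by (rule continuous_on_Icc_bounded[OF f]) blast
  obtain B where B: "0 \<le> B" "\<And>t. t \<in> {-1..1} \<Longrightarrow> \<bar>g t\<bar> \<le> B"
    by (rule continuous_on_Icc_bounded[OF g]) blast
  show ?thesis
  proof (rule cfc_eqI[OF h])
    show "continuous_on {-1..1} (\<lambda>t. f t * g t)"
      by (intro continuous_intros f g)
    fix e :: real assume e: "0 < e" "e \<le> 1"
    obtain p q where p: "\<And>t. t \<in> {-1..1} \<Longrightarrow> \<bar>f t - poly p t\<bar> \<le> e"
      and q: "\<And>t. t \<in> {-1..1} \<Longrightarrow> \<bar>g t - poly q t\<bar> \<le> e"
      using real_poly_approx[OF f \<open>0 < e\<close>] real_poly_approx[OF g \<open>0 < e\<close>] by metis
    have 1: "\<bar>f t * g t - poly (p * q) t\<bar> \<le> (A + B + 1) * e" if t: "t \<in> {-1..1}" for t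
    proof -
      have "\<bar>poly q t\<bar> \<le> B + 1" using q[OF t] B(2)[OF t] e by linarith
      then have "\<bar>f t\<bar> * \<bar>g t - poly q t\<bar> + \<bar>f t - poly p t\<bar> * \<bar>poly q t\<bar> \<le> A * e + e * (B + 1)"
        using p[OF t] q[OF t] A(1) A(2)[OF t] e B(1) by (intro add_mono mult_mono) auto
      moreover have "f t * g t - poly (p * q) t = f t * (g t - poly q t) + (f t - poly p t) * poly q t"
        by (simp add: algebra_simps)
      ultimately have "\<bar>f t * g t - poly (p * q) t\<bar> \<le> A * e + e * (B + 1)"
        using abs_triangle_ineq[of "f t * (g t - poly q t)" "(f t - poly p t) * poly q t"]
        by (simp only: abs_mult)
      then show ?thesis by (simp only: distrib_left distrib_right mult_1_right mult_1_left mult.commute add_ac)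
    qed
    let ?y = "cfc h g x"
    have "norm (cfc h f ?y - poly_op h p ?y) \<le> e * norm ?y"
      by (rule cfc_poly_op_dist[OF h f p])
    also have "\<dots> \<le> e * (B * norm x)"
      using e by (intro mult_left_mono cfc_bound[OF h g B(2)]) auto
    finally have 2: "norm (cfc h f ?y - poly_op h p ?y) \<le> e * (B * norm x)" .
    have "norm (poly_op h p (?y - poly_op h q x)) \<le> (A + 1) * norm (?y - poly_op h q x)"
    proof (rule norm_poly_op_le)
      fix t :: real assume "-1 \<le> t" "t \<le> 1"
      then have t: "t \<in> {-1..1}" by simp
      show "\<bar>poly p t\<bar> \<le> A + 1" using p[OF t] A(2)[OF t] e by linarith
    qed (use h in \<open>simp_all add: sa_contraction_def\<close>)
    also have "\<dots> \<le> (A + 1) * (e * norm x)"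
      using A(1) by (intro mult_left_mono cfc_poly_op_dist[OF h g q]) auto
    finally have 3: "norm (poly_op h p (?y - poly_op h q x)) \<le> (A + 1) * (e * norm x)" .
    have "norm (cfc h f ?y - poly_op h (p * q) x) \<le> e * (B * norm x) + (A + 1) * (e * norm x)"
      using norm_triangle_mono[OF 2 3] by (simp add: poly_op_diff_right poly_op_mult)
    then show "\<exists>p. (\<forall>t\<in>{-1..1}. \<bar>f t * g t - poly p t\<bar> \<le> (A + B + 1) * e)
        \<and> norm (cfc h f ?y - poly_op h p x) \<le> ((A + B + 1) * norm x) * e"
      using 1 by (intro exI[of _ "p * q"]) (simp add: algebra_simps)
  qed
qed

lemma cfc_id: "sa_contraction h \<Longrightarrow> cfc h (\<lambda>t. t) x = h * x"
  using cfc_poly[of h "\<lambda>t. t" "[:0, 1:]" x] by simp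

lemma cfc_mult_right:
  fixes h x y :: "'a::cstar_algebra"
  assumes h: "sa_contraction h" and f: "continuous_on {-1..1} f"
  shows "cfc h f x * y = cfc h f (x * y)"
proof (rule cfc_eqI[OF h f])
  fix e :: real assume e: "0 < e" "e \<le> 1"
  obtain p where p: "\<And>t. t \<in> {-1..1} \<Longrightarrow> \<bar>f t - poly p t\<bar> \<le> e"
    using real_poly_approx[OF f e(1)] by blast
  have "norm (cfc h f x * y - poly_op h p (x * y)) = norm ((cfc h f x - poly_op h p x) * y)"
    by (simp add: poly_op_mult_right left_diff_distrib)
  also have "\<dots> \<le> e * norm x * norm y"
    by (meson cfc_poly_op_dist[OF h f p] mult_right_mono norm_ge_zero norm_mult_ineq order_trans)
  finally show "\<exists>p. (\<forall>t\<in>{-1..1}. \<bar>f t - poly p t\<bar> \<le> 1 * e) \<and>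
      norm (cfc h f x * y - poly_op h p (x * y)) \<le> (norm x * norm y) * e"
    using p by (intro exI[of _ p]) (simp add: mult_ac)
qed

lemma cfc_adj:
  fixes h x y :: "'a::cstar_algebra"
  assumes h: "sa_contraction h" and f: "continuous_on {-1..1} f"
  shows "adj (cfc h f x) * y = adj x * cfc h f y"
proof -
  have "norm (adj (cfc h f x) * y - adj x * cfc h f y) \<le> 0 + (2 * norm x * norm y) * e" if e: "0 < e" "e \<le> 1" for e
  proof -
    obtain p where p: "\<And>t. t \<in> {-1..1} \<Longrightarrow> \<bar>f t - poly p t\<bar> \<le> e"
      using real_poly_approx[OF f e(1)] by blast
    have "norm (adj (cfc h f x - poly_op h p x) * y) \<le> e * norm x * norm y"
      using cfc_poly_op_dist[OF h f p, of x] norm_mult_ineq[of "adj (cfc h f x - poly_op h p x)" y]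
        mult_right_mono[of "norm (cfc h f x - poly_op h p x)" "e * norm x" "norm y"] by simp
    moreover have "norm (adj x * (cfc h f y - poly_op h p y)) \<le> norm x * (e * norm y)"
      using cfc_poly_op_dist[OF h f p, of y] norm_mult_ineq[of "adj x" "cfc h f y - poly_op h p y"]
        mult_left_mono[of "norm (cfc h f y - poly_op h p y)" "e * norm y" "norm x"] by simp
    moreover have "adj (cfc h f x) * y - adj x * cfc h f y
        = adj (cfc h f x - poly_op h p x) * y - adj x * (cfc h f y - poly_op h p y)"
      using poly_op_adj[OF sa_contractionD(1)[OF h], of p x y]
      by (simp add: adj_diff left_diff_distrib right_diff_distrib)
    ultimately show ?thesis
      using norm_triangle_ineq4[of "adj (cfc h f x - poly_op h p x) * y" "adj x * (cfc h f y - poly_op h p y)"]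
      by (simp add: algebra_simps)
  qed
  then have "norm (adj (cfc h f x) * y - adj x * cfc h f y) \<le> 0"
    by (rule real_le_of_scaled_epsilon)
  then show ?thesis by simp
qed

text \<open>\<open>cfc h g h\<close> is the element (t g(t))(h): a function with a factor t yields
  an element of the algebra and not only an operator. Elements are determined by their left
  multiplication, so comparing the actions on \<open>y\<close> is enough.\<close>

lemma cfc_selfadjoint:
  fixes h :: "'a::cstar_algebra"
  assumes h: "sa_contraction h" and g: "continuous_on {-1..1} g"
  shows "adj (cfc h g h) = cfc h g h"
proof -
  have "(adj (cfc h g h) - cfc h g h) * y = 0" for y
  proof -
    have "adj (cfc h g h) * y = cfc h (\<lambda>t. t) (cfc h g y)"
      using h by (simp add: cfc_adj[OF h g] cfc_id sa_contractionD)
    also have "\<dots> = cfc h g (cfc h (\<lambda>t. t) y)"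
      by (simp add: cfc_mult[OF h] g continuous_on_id mult.commute)
    also have "\<dots> = cfc h g h * y"
      by (simp add: cfc_id[OF h] cfc_mult_right[OF h g])
    finally show ?thesis by (simp add: left_diff_distrib)
  qed
  then show ?thesis using cstar_zeroI by fastforce
qed

section \<open>Perturbation and composition in the functional calculus\<close>

lemma poly_op_bounded:
  "\<exists>D\<ge>0. \<forall>(h::'a::cstar_algebra) x. norm h \<le> 1 \<longrightarrow> norm (poly_op h p x) \<le> D * norm x"
proof (induction p)
  case 0
  then show ?case by (intro exI[of _ 0]) simp
next
  case (pCons c p)
  then obtain D where D: "D \<ge> 0" "\<And>(h::'a) x. norm h \<le> 1 \<Longrightarrow> norm (poly_op h p x) \<le> D * norm x"
    by blast
  have "norm (poly_op h (pCons c p) x) \<le> (\<bar>c\<bar> + D) * norm x" if "norm h \<le> 1" for h x :: 'a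
  proof -
    have "norm (h * poly_op h p x) \<le> norm h * norm (poly_op h p x)"
      by (rule norm_mult_ineq)
    also have "\<dots> \<le> 1 * (D * norm x)"
      using that D by (intro mult_mono) auto
    finally show ?thesis
      using norm_triangle_ineq[of "c *\<^sub>R x" "h * poly_op h p x"] by (simp add: distrib_right)
  qed
  then show ?case using D(1) by (intro exI[of _ "\<bar>c\<bar> + D"]) auto
qed

lemma poly_op_Lipschitz:
  "\<exists>C\<ge>0. \<forall>(h::'a::cstar_algebra) h' x. norm h \<le> 1 \<longrightarrow> norm h' \<le> 1 \<longrightarrow>
     norm (poly_op h p x - poly_op h' p x) \<le> C * norm (h - h') * norm x"
proof (induction p)
  case 0
  then show ?case by (intro exI[of _ 0]) simp
next
  case (pCons c p)
  then obtain C where C: "C \<ge> 0" "\<And>(h::'a) h' x. \<lbrakk>norm h \<le> 1; norm h' \<le> 1\<rbrakk> \<Longrightarrow>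
      norm (poly_op h p x - poly_op h' p x) \<le> C * norm (h - h') * norm x"
    by blast
  obtain D where D: "D \<ge> 0" "\<And>(h::'a) x. norm h \<le> 1 \<Longrightarrow> norm (poly_op h p x) \<le> D * norm x"
    using poly_op_bounded by blast
  have "norm (poly_op h (pCons c p) x - poly_op h' (pCons c p) x) \<le> (D + C) * norm (h - h') * norm x"
    if "norm h \<le> 1" "norm h' \<le> 1" for h h' x :: 'a
  proof -
    have "norm (h - h') * norm (poly_op h p x) \<le> norm (h - h') * (D * norm x)"
      by (rule mult_left_mono[OF D(2)[OF that(1)]]) simp
    then have "norm ((h - h') * poly_op h p x) \<le> norm (h - h') * (D * norm x)"
      by (rule order_trans[OF norm_mult_ineq])
    moreover have "norm h' * norm (poly_op h p x - poly_op h' p x) \<le> 1 * (C * norm (h - h') * norm x)"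
      by (rule mult_mono[OF that(2) C(2)[OF that]]) simp_all
    then have "norm (h' * (poly_op h p x - poly_op h' p x)) \<le> C * norm (h - h') * norm x"
      using order_trans[OF norm_mult_ineq] by (metis mult_1_left)
    moreover have "poly_op h (pCons c p) x - poly_op h' (pCons c p) x
        = (h - h') * poly_op h p x + h' * (poly_op h p x - poly_op h' p x)"
      by (simp add: algebra_simps)
    ultimately show ?thesis
      using norm_triangle_ineq[of "(h - h') * poly_op h p x" "h' * (poly_op h p x - poly_op h' p x)"]
      by (simp add: algebra_simps)
  qed
  then show ?case using C(1) D(1) by (intro exI[of _ "D + C"]) auto
qed

text \<open>The order of quantifiers is the point: \<delta> depends on \<open>f\<close> and
  \<open>e\<close> only, because a polynomial close to \<open>f\<close> is Lipschitz in
  \<open>h\<close> uniformly on the unit ball. Tolerances can thus be fixed before the Rokhlin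
  elements are known.\<close>

lemma cfc_uniformly_continuous:
  assumes f: "continuous_on {-1..1} f" and "0 < e"
  shows "\<exists>\<delta>>0. \<forall>(h::'a::cstar_algebra) h' x. sa_contraction h \<longrightarrow> sa_contraction h' \<longrightarrow>
    norm (h - h') < \<delta> \<longrightarrow> norm (cfc h f x - cfc h' f x) \<le> e * norm x"
proof -
  have "e / 3 > 0" using \<open>0 < e\<close> by simp
  then obtain p where p: "\<And>t. t \<in> {-1..1} \<Longrightarrow> \<bar>f t - poly p t\<bar> \<le> e / 3"
    using real_poly_approx[OF f] by blast
  obtain C where C: "C \<ge> 0" "\<And>(h::'a) h' x. \<lbrakk>norm h \<le> 1; norm h' \<le> 1\<rbrakk> \<Longrightarrow>
      norm (poly_op h p x - poly_op h' p x) \<le> C * norm (h - h') * norm x"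
    using poly_op_Lipschitz by blast
  define \<delta> where "\<delta> = e / (3 * (C + 1))"
  have "norm (cfc h f x - cfc h' f x) \<le> e * norm x"
    if h: "sa_contraction h" "sa_contraction h'" "norm (h - h') < \<delta>" for h h' x :: 'a
  proof -
    have "C * norm (h - h') \<le> (C + 1) * \<delta>"
      using h(3) C(1) by (intro mult_mono) auto
    also have "\<dots> = e / 3" using C(1) by (simp add: \<delta>_def field_simps)
    finally have "C * norm (h - h') * norm x \<le> e / 3 * norm x"
      by (intro mult_right_mono) auto
    then have "norm (poly_op h p x - poly_op h' p x) \<le> e / 3 * norm x"
      using C(2)[of h h' x] h by (simp add: sa_contraction_def)
    moreover have "norm (cfc h f x - poly_op h p x) \<le> e / 3 * norm x"
      by (rule cfc_poly_op_dist[OF h(1) f p])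
    moreover have "norm (cfc h' f x - poly_op h' p x) \<le> e / 3 * norm x"
      by (rule cfc_poly_op_dist[OF h(2) f p])
    moreover have "norm (cfc h f x - cfc h' f x) \<le> norm (cfc h f x - poly_op h p x)
        + norm (poly_op h p x - poly_op h' p x) + norm (cfc h' f x - poly_op h' p x)"
      using norm_triangle_ineq4[of "cfc h f x - poly_op h' p x" "cfc h' f x - poly_op h' p x"]
        norm_triangle_ineq[of "cfc h f x - poly_op h p x" "poly_op h p x - poly_op h' p x"] by simp
    ultimately show ?thesis by (simp add: field_simps)
  qed
  moreover have "\<delta> > 0" using \<open>0 < e\<close> C(1) by (simp add: \<delta>_def)
  ultimately show ?thesis by blast
qed

text \<open>The hypothesis on \<open>m\<close> expresses m = q(h) through left multiplication,
  without a unit. It is applied to turn functions of s^8 into functions of s.\<close>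

lemma cfc_compose_poly:
  fixes h m x :: "'a::cstar_algebra"
  assumes h: "sa_contraction h" and m: "sa_contraction m" and f: "continuous_on {-1..1} f"
    and q: "\<And>t. t \<in> {-1..1} \<Longrightarrow> poly q t \<in> {-1..1}" and hm: "\<And>x. m * x = poly_op h q x"
  shows "cfc m f x = cfc h (\<lambda>t. f (poly q t)) x"
proof (rule cfc_eqI[OF h])
  show "continuous_on {-1..1} (\<lambda>t. f (poly q t))"
    by (rule continuous_on_compose2[OF f]) (use q in \<open>auto intro!: continuous_intros\<close>)
  fix e :: real assume e: "0 < e" "e \<le> 1"
  obtain p where p: "\<And>t. t \<in> {-1..1} \<Longrightarrow> \<bar>f t - poly p t\<bar> \<le> e"
    using real_poly_approx[OF f e(1)] by blast
  have "poly_op m p x = poly_op h (pcompose p q) x"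
    by (induction p) (auto simp: pcompose_pCons poly_op_add poly_op_mult hm)
  then have "norm (cfc m f x - poly_op h (pcompose p q) x) \<le> norm x * e"
    using cfc_poly_op_dist[OF m f p, of x] by (simp add: mult.commute)
  then show "\<exists>p. (\<forall>t\<in>{-1..1}. \<bar>f (poly q t) - poly p t\<bar> \<le> 1 * e) \<and> norm (cfc m f x - poly_op h p x) \<le> norm x * e"
    using p q by (intro exI[of _ "pcompose p q"]) (auto simp: poly_pcompose)
qed

section \<open>Common local units\<close>

text \<open>For \<open>k > 0\<close> it is 0 up to \<open>k\<close> and 1 from \<open>2 * k\<close>
  on. Vanishing on a whole neighbourhood of 0 is what later makes approximate inverses
  exact.\<close>

definition cutoff :: "real \<Rightarrow> real \<Rightarrow> real" where
  "cutoff k t = max 0 (min 1 ((t - k) / k))"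

lemma cutoff_bounds: "0 \<le> cutoff k t" "cutoff k t \<le> 1"
  by (auto simp: cutoff_def)

lemma cutoff_eq_0: "0 < k \<Longrightarrow> t \<le> k \<Longrightarrow> cutoff k t = 0"
  using divide_nonpos_pos[of "t - k" k] by (simp add: cutoff_def)

lemma cutoff_eq_1: "0 < k \<Longrightarrow> 2 * k \<le> t \<Longrightarrow> cutoff k t = 1"
  by (simp add: cutoff_def max_def min_def field_simps)

lemma continuous_on_cutoff: "continuous_on S (cutoff k)"
  unfolding cutoff_def by (cases "k = 0") (auto intro!: continuous_intros)

text \<open>On \<open>[k, \<infinity>)\<close> this is \<open>t \<mapsto> t powr (- 1/2)\<close>.\<close>

definition inv_sqrt :: "real \<Rightarrow> real \<Rightarrow> real" where
  "inv_sqrt k t = sqrt (max t 0) / max t k"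

text \<open>A quotient by t: \<open>cfc m (eighth_root_quot k) m\<close> is the eighth root of m
  times the cutoff. Its square behaves like the fourth root and is visibly of the form
  \<open>adj b * b\<close>.\<close>

definition eighth_root_quot :: "real \<Rightarrow> real \<Rightarrow> real" where
  "eighth_root_quot k t = sqrt (sqrt (sqrt (max t 0))) / max t k * cutoff k t"

lemma continuous_inv_sqrt: "0 < k \<Longrightarrow> continuous_on S (inv_sqrt k)"
  unfolding inv_sqrt_def by (intro continuous_intros) auto

lemma continuous_eighth_root_quot: "0 < k \<Longrightarrow> continuous_on S (eighth_root_quot k)"
  unfolding eighth_root_quot_def by (intro continuous_intros continuous_on_cutoff) auto

lemma inv_sqrt_square_le: "0 < k \<Longrightarrow> \<bar>inv_sqrt k t * (t * inv_sqrt k t)\<bar> \<le> 1"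
proof (cases "t > 0")
  case True
  assume "0 < k"
  have "inv_sqrt k t * (t * inv_sqrt k t) = (t / max t k)\<^sup>2"
    using True by (simp add: inv_sqrt_def power2_eq_square)
  moreover have "(t / max t k)\<^sup>2 \<le> 1"
    using True by (intro power_le_one) auto
  ultimately show ?thesis by simp
qed (simp add: inv_sqrt_def)

text \<open>Above \<open>k\<close> the square of \<open>inv_sqrt\<close> is exactly the inverse of
  t, and up to \<open>k\<close> the cutoff kills both sides. This is the source of the exact
  equation for w.\<close>

lemma inv_sqrt_square_eighth_root_quot:
  assumes "0 < k"
  shows "inv_sqrt k t * (t * inv_sqrt k t) * eighth_root_quot k t = eighth_root_quot k t"
proof (cases "t \<le> k")
  case True
  then show ?thesis using assms by (simp add: eighth_root_quot_def cutoff_eq_0)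
next
  case False
  then have "inv_sqrt k t * (t * inv_sqrt k t) = 1"
    using assms by (simp add: inv_sqrt_def)
  then show ?thesis by (simp only: mult_1_left)
qed

definition quartic_root_cut :: "real \<Rightarrow> real \<Rightarrow> real" where
  "quartic_root_cut k t = (t * eighth_root_quot k t) * (t * eighth_root_quot k t)"

lemma continuous_quartic_root_cut: "0 < k \<Longrightarrow> continuous_on S (quartic_root_cut k)"
  unfolding quartic_root_cut_def by (intro continuous_intros continuous_eighth_root_quot)

lemma quartic_root_cut_eq:
  assumes "0 < k"
  shows "quartic_root_cut k t = sqrt (sqrt (max t 0)) * (cutoff k t)\<^sup>2"
proof (cases "t \<le> k")
  case True
  then show ?thesis using assms by (simp add: quartic_root_cut_def eighth_root_quot_def cutoff_eq_0)
next
  case False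
  then have "t * eighth_root_quot k t = sqrt (sqrt (sqrt t)) * cutoff k t"
    using assms by (simp add: eighth_root_quot_def)
  then have "quartic_root_cut k t = (sqrt (sqrt (sqrt t)) * sqrt (sqrt (sqrt t))) * (cutoff k t * cutoff k t)"
    by (simp add: quartic_root_cut_def mult_ac)
  then show ?thesis
    using False assms by (simp add: power2_eq_square)
qed

lemma quartic_root_cut_bound:
  assumes "0 < k" "t \<le> 1"
  shows "\<bar>quartic_root_cut k t\<bar> \<le> 1"
proof -
  have "sqrt (sqrt (max t 0)) \<le> 1" using assms by simp
  moreover have "(cutoff k t)\<^sup>2 \<le> 1"
    by (intro power_le_one cutoff_bounds)
  ultimately show ?thesis
    unfolding quartic_root_cut_eq[OF assms(1)] by (simp add: abs_mult mult_le_one)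
qed

lemma sqrt_sqrt_power8: "sqrt (sqrt (max (t ^ 8) 0)) = t\<^sup>2" for t :: real
proof -
  have "max (t ^ 8) 0 = (t\<^sup>2 * t\<^sup>2) * (t\<^sup>2 * t\<^sup>2)"
    by (simp add: max_def flip: power_add power_mult)
  then show ?thesis by (simp only: real_sqrt_abs2 abs_mult abs_power2)
qed

lemma quartic_root_cut_power8:
  assumes "0 < k"
  shows "quartic_root_cut k (t ^ 8) = t\<^sup>2 * (cutoff k (t ^ 8))\<^sup>2"
  by (simp only: quartic_root_cut_eq[OF assms] sqrt_sqrt_power8)

text \<open>With t standing for s this is s^4 s^-4 s^2 up to the cutoff: the value of
  \<open>d * w * e'\<close> in the model case where \<open>d\<close> and \<open>e\<close> equal
  s^2.\<close>

lemma inv_sqrt_quartic_root_cut_power8: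
  assumes "0 < k"
  shows "t ^ 4 * (inv_sqrt k (t ^ 8) * quartic_root_cut k (t ^ 8)) = t\<^sup>2 * (cutoff k (t ^ 8))\<^sup>2"
proof (cases "t ^ 8 \<le> k")
  case True
  then show ?thesis by (simp add: quartic_root_cut_power8 assms cutoff_eq_0)
next
  case False
  then have "t \<noteq> 0" using assms by auto
  have "sqrt (t ^ 8) = t ^ 4"
    using real_sqrt_abs[of "t ^ 4"] by (simp flip: power_mult)
  then have "inv_sqrt k (t ^ 8) = t ^ 4 / t ^ 8"
    using False assms by (simp add: inv_sqrt_def max_def)
  moreover have "t ^ 4 * (t ^ 4 / t ^ 8) = 1"
    using \<open>t \<noteq> 0\<close> by (simp flip: power_add)
  ultimately show ?thesis
    by (simp only: quartic_root_cut_power8[OF assms] mult.assoc[symmetric] mult_1_left)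
qed

text \<open>The cutoff differs from 1 only where t^8 < 2 k = c^4, that is t^2 < c, and there both
  terms lie between 0 and c. This explains the choice of \<open>k\<close>.\<close>

lemma square_cutoff_dist:
  fixes t :: real
  assumes "0 < c" and k: "k = c ^ 4 / 2"
  shows "\<bar>t\<^sup>2 * (cutoff k (t ^ 8))\<^sup>2 - t\<^sup>2\<bar> \<le> c"
proof (cases "2 * k \<le> t ^ 8")
  case True
  have "k > 0" unfolding k using assms by simp
  then have "cutoff k (t ^ 8) = 1" by (rule cutoff_eq_1[OF _ True])
  then show ?thesis using \<open>0 < c\<close> by simp
next
  case False
  then have "(t\<^sup>2) ^ 4 < c ^ 4" by (simp add: k flip: power_mult)
  then have "t\<^sup>2 < c"
    by (rule power_less_imp_less_base) (use \<open>0 < c\<close> in simp)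
  moreover have "(cutoff k (t ^ 8))\<^sup>2 \<le> 1"
    by (intro power_le_one cutoff_bounds)
  then have "t\<^sup>2 * (cutoff k (t ^ 8))\<^sup>2 \<le> t\<^sup>2"
    by (simp add: mult_left_le)
  moreover have "0 \<le> t\<^sup>2 * (cutoff k (t ^ 8))\<^sup>2" by simp
  ultimately show ?thesis by linarith
qed

lemma norm_mult_le_contraction:
  fixes x y :: "'a::real_normed_algebra"
  shows "norm x \<le> 1 \<Longrightarrow> norm (x * y) \<le> norm y" "norm y \<le> 1 \<Longrightarrow> norm (x * y) \<le> norm x"
  using norm_mult_ineq[of x y] mult_right_mono[of "norm x" 1 "norm y"] mult_left_mono[of "norm y" 1 "norm x"]
  by simp_all

lemma norm_mult_diff_le:
  fixes a b c d :: "'a::real_normed_algebra"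
  assumes "norm b \<le> 1" "norm c \<le> 1"
  shows "norm (a * b - c * d) \<le> norm (a - c) + norm (b - d)"
proof -
  have "a * b - c * d = (a - c) * b + c * (b - d)" by (simp add: algebra_simps)
  moreover have "norm ((a - c) * b) \<le> norm (a - c)" "norm (c * (b - d)) \<le> norm (b - d)"
    using assms by (simp_all add: norm_mult_le_contraction)
  ultimately show ?thesis
    using norm_triangle_ineq[of "(a - c) * b" "c * (b - d)"] by simp
qed

text \<open>With \<open>m = e d\<^sup>2 e\<close> and \<open>h = inv_sqrt k\<close> take \<open>w = e h(m)\<close> and \<open>e' = f(m)\<close> for a function
  \<open>f\<close> close to the fourth root and vanishing near \<open>0\<close>. Then \<open>w\<^sup>* d\<^sup>2 w = h(m) m h(m)\<close> is a unit for
  \<open>e'\<close>. Both \<open>e\<close> and \<open>d\<close> are close to \<open>s\<^sup>2\<close>, so \<open>m\<close> is close to \<open>s\<^sup>8\<close> and \<open>e'\<close> is close to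
  \<open>f(s\<^sup>8)\<close>, hence to \<open>s\<^sup>2\<close>.\<close>

lemma local_unit_step:
  assumes "0 < \<eta>"
  shows "\<exists>\<delta>>0. \<forall>s d e :: 'a::cstar_algebra.
    sa_contraction s \<longrightarrow> sa_contraction d \<longrightarrow> cstar_positive e \<longrightarrow> norm e \<le> 1 \<longrightarrow>
    norm (d - s * s) < \<delta> \<longrightarrow> norm (e - s * s) < \<delta> \<longrightarrow>
    (\<exists>e' w. cstar_positive e' \<and> norm e' \<le> 1 \<and> norm (e' - s * s) < \<eta> \<and>
       (\<forall>x. x * e = e \<longrightarrow> x * e' = e') \<and> adj w * d * d * w * e' = e' \<and>
       (\<forall>x. norm (d * w * x) \<le> norm x) \<and> norm (d * w * e' - s * s) < \<eta>)"
proof -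
  \<comment> \<open>Half of \<eta> pays for the cutoff. Perturbation costs \<eta>/8 per term, one
    term for \<open>e'\<close> and two for \<open>d * w * e'\<close>.\<close>
  define c where "c = \<eta> / 2"
  define k where "k = c ^ 4 / 2"
  have c: "0 < c" using assms by (simp add: c_def)
  then have k: "0 < k" by (simp add: k_def)
  define f where "f = quartic_root_cut k"
  define g where "g = eighth_root_quot k"
  define h where "h = inv_sqrt k"
  define q where "q t = h t * f t" for t
  have cf: "continuous_on {-1..1} f" and cg: "continuous_on {-1..1} g" and ch: "continuous_on {-1..1} h"
    using k by (auto simp: f_def g_def h_def intro: continuous_quartic_root_cut continuous_eighth_root_quot continuous_inv_sqrt)
  then have cq: "continuous_on {-1..1} q"
    unfolding q_def by (intro continuous_intros)
  obtain K where K: "0 \<le> K" "\<And>t. t \<in> {-1..1} \<Longrightarrow> \<bar>q t\<bar> \<le> K"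
    by (rule continuous_on_Icc_bounded[OF cq]) blast
  have "\<eta> / 8 > 0" using assms by simp
  obtain \<delta>1 where \<delta>1: "\<delta>1 > 0" "\<And>(m::'a) n x. \<lbrakk>sa_contraction m; sa_contraction n; norm (m - n) < \<delta>1\<rbrakk>
      \<Longrightarrow> norm (cfc m f x - cfc n f x) \<le> \<eta> / 8 * norm x"
    using cfc_uniformly_continuous[OF cf \<open>\<eta> / 8 > 0\<close>, where 'a = 'a] by blast
  obtain \<delta>2 where \<delta>2: "\<delta>2 > 0" "\<And>(m::'a) n x. \<lbrakk>sa_contraction m; sa_contraction n; norm (m - n) < \<delta>2\<rbrakk>
      \<Longrightarrow> norm (cfc m q x - cfc n q x) \<le> \<eta> / 8 * norm x"
    using cfc_uniformly_continuous[OF cq \<open>\<eta> / 8 > 0\<close>, where 'a = 'a] by blast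
  \<comment> \<open>\<open>m\<close> has four factors, each within \<delta> of s^2, hence the
    quarters. The first bound handles the error of \<open>d * e\<close>, below 2 \<delta>, times the
    bound \<open>K\<close> on \<open>q\<close>.\<close>
  define \<delta> where "\<delta> = min (\<eta> / (16 * (K + 1))) (min (\<delta>1 / 4) (\<delta>2 / 4))"
  have "\<delta> > 0" using assms \<delta>1 \<delta>2 K by (simp add: \<delta>_def)
  moreover have "\<exists>e' w. cstar_positive e' \<and> norm e' \<le> 1 \<and> norm (e' - s * s) < \<eta> \<and>
       (\<forall>x. x * e = e \<longrightarrow> x * e' = e') \<and> adj w * d * d * w * e' = e' \<and>
       (\<forall>x. norm (d * w * x) \<le> norm x) \<and> norm (d * w * e' - s * s) < \<eta>"
    if s: "sa_contraction s" and d: "sa_contraction d" and e: "cstar_positive e" "norm e \<le> 1"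
      and ds: "norm (d - s * s) < \<delta>" and es: "norm (e - s * s) < \<delta>" for s d e :: 'a
  proof -
    note adjs = sa_contractionD(1)[OF s] sa_contractionD(1)[OF d] cstar_positive_selfadjoint[OF e(1)]
    note nrm = sa_contractionD(2)[OF s] sa_contractionD(2)[OF d] e(2)
    define r where "r = s * s"
    define m where "m = (e * d) * (d * e)"
    define m' where "m' = (r * r) * (r * r)"
    have nr: "norm r \<le> 1" unfolding r_def using nrm norm_mult_le_contraction(1) order_trans by blast
    have nrr: "norm (r * r) \<le> 1" "norm (d * e) \<le> 1" "norm (e * d) \<le> 1"
      using nr nrm norm_mult_le_contraction(1) order_trans by blast+
    have m: "sa_contraction m"
      unfolding sa_contraction_def m_def
      using order_trans[OF norm_mult_le_contraction(1)[OF nrr(3)] nrr(2)] adjs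
      by (simp add: adj_mult mult.assoc)
    have m': "sa_contraction m'"
      unfolding sa_contraction_def m'_def
      using order_trans[OF norm_mult_le_contraction(1)[OF nrr(1)] nrr(1)] adjs
      by (simp add: adj_mult r_def mult.assoc)
    have "norm (d * e - r * r) \<le> norm (d - r) + norm (e - r)" "norm (e * d - r * r) \<le> norm (e - r) + norm (d - r)"
      using nrm nr by (intro norm_mult_diff_le; simp)+
    then have de: "norm (d * e - r * r) < 2 * \<delta>" "norm (e * d - r * r) < 2 * \<delta>"
      using ds es by (auto simp: r_def)
    have "norm (m - m') \<le> norm (e * d - r * r) + norm (d * e - r * r)"
      unfolding m_def m'_def using nrr by (intro norm_mult_diff_le)
    also have "\<dots> < 4 * \<delta>" using de by simp
    finally have mm': "norm (m - m') < \<delta>1" "norm (m - m') < \<delta>2"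
      by (auto simp: \<delta>_def)
    define Q :: "real poly" where "Q = [:0, 1:] * [:0, 1:]"
    have Q: "poly Q t = t\<^sup>2" for t by (simp add: Q_def power2_eq_square)
    have r: "r * x = poly_op s Q x" for x
      by (simp add: r_def Q_def mult.assoc)
    have m'x: "m' * x = poly_op s ((Q * Q) * (Q * Q)) x" for x
      by (simp only: m'_def poly_op_mult mult.assoc flip: r)
    have QQ: "poly ((Q * Q) * (Q * Q)) t = t ^ 8" for t
      by (simp add: Q flip: power_add)
    have range: "t ^ 8 \<in> {-1..1}" if "t \<in> {-1..1}" for t :: real
    proof -
      have "\<bar>t\<bar> ^ 8 \<le> 1" using that by (intro power_le_one) auto
      then have "\<bar>t ^ 8\<bar> \<le> 1" by (simp only: power_abs)
      then show ?thesis unfolding abs_le_iff atLeastAtMost_iff by linarith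
    qed
    have comp: "cfc m' u x = cfc s (\<lambda>t. u (t ^ 8)) x" if "continuous_on {-1..1} u" for u x
      using cfc_compose_poly[OF s m' that _ m'x, of x] range unfolding QQ by blast
    have c8: "continuous_on {-1..1} (\<lambda>t. u (t ^ 8))" if "continuous_on {-1..1} u" for u :: "real \<Rightarrow> real"
      by (rule continuous_on_compose2[OF that]) (use range in \<open>auto intro!: continuous_intros\<close>)
    have cfc_r: "r * x = cfc s (\<lambda>t. t\<^sup>2) x" for x
      by (simp only: r) (rule cfc_poly[OF s, symmetric], simp add: Q)
    have cfc_rr: "r * (r * x) = cfc s (\<lambda>t. t ^ 4) x" for x
      unfolding r poly_op_mult[symmetric] by (rule cfc_poly[OF s, symmetric]) (simp add: Q flip: power_add)
    have limit: "norm (cfc s (\<lambda>t. t\<^sup>2 * (cutoff k (t ^ 8))\<^sup>2) x - r * x) \<le> \<eta> / 2 * norm x" for x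
      unfolding cfc_r
    proof (rule cfc_diff_bound[OF s])
      show "continuous_on {-1..1} (\<lambda>t. t\<^sup>2 * (cutoff k (t ^ 8))\<^sup>2)"
        using c8[OF cf] by (simp add: f_def quartic_root_cut_power8[OF k])
      show "continuous_on {-1..1} (\<lambda>t::real. t\<^sup>2)"
        by (intro continuous_intros)
      fix t :: real
      show "\<bar>t\<^sup>2 * (cutoff k (t ^ 8))\<^sup>2 - t\<^sup>2\<bar> \<le> \<eta> / 2"
        using square_cutoff_dist[OF c k_def, of t] by (simp only: c_def)
    qed

    define b where "b = cfc m g m"
    define e' where "e' = b * b"
    define w where "w = adj (cfc m h e)"
    have b_adj: "adj b = b" unfolding b_def by (rule cfc_selfadjoint[OF m cg])
    have b_mult: "b * x = cfc m (\<lambda>t. t * g t) x" for x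
    proof -
      have "b * x = cfc m g (cfc m (\<lambda>t. t) x)"
        by (simp add: b_def cfc_mult_right[OF m cg] cfc_id[OF m])
      then show ?thesis by (simp add: cfc_mult[OF m cg] continuous_on_id mult.commute)
    qed
    have ctg: "continuous_on {-1..1} (\<lambda>t. t * g t)"
      by (intro continuous_intros cg)
    have e'_mult: "e' * x = cfc m f x" for x
    proof -
      have "(\<lambda>t. t * g t * (t * g t)) = f"
        by (simp add: f_def g_def quartic_root_cut_def fun_eq_iff)
      moreover have "e' * x = b * (b * x)" by (simp only: e'_def mult.assoc)
      ultimately show ?thesis
        using cfc_mult[OF m ctg ctg, of x] by (simp only: b_mult)
    qed
    have pos: "cstar_positive e'"
      unfolding cstar_positive_def e'_def by (rule exI[of _ b]) (simp add: b_adj)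
    have "norm (e' * x) \<le> 1 * norm x" for x
      unfolding e'_mult by (rule cfc_bound[OF m cf]) (simp add: f_def quartic_root_cut_bound[OF k])
    then have norm_e': "norm e' \<le> 1" by (rule cstar_norm_le[rotated]) simp

    have "norm ((e' - r) * x) \<le> 5 / 8 * \<eta> * norm x" for x
    proof -
      have "norm (cfc m f x - cfc m' f x) \<le> \<eta> / 8 * norm x"
        by (rule \<delta>1(2)[OF m m' mm'(1)])
      moreover have "norm (cfc m' f x - r * x) \<le> \<eta> / 2 * norm x"
      proof -
        have "(\<lambda>t. f (t ^ 8)) = (\<lambda>t. t\<^sup>2 * (cutoff k (t ^ 8))\<^sup>2)"
          by (simp only: f_def quartic_root_cut_power8[OF k])
        then show ?thesis using limit[of x] comp[OF cf, of x] by (simp only:)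
      qed
      moreover have "(e' - r) * x = (cfc m f x - cfc m' f x) + (cfc m' f x - r * x)"
        by (simp add: left_diff_distrib e'_mult)
      ultimately have "norm ((e' - r) * x) \<le> \<eta> / 8 * norm x + \<eta> / 2 * norm x"
        by (simp only:) (intro norm_triangle_le add_mono; assumption)
      then show ?thesis by simp
    qed
    then have "norm (e' - r) \<le> 5 / 8 * \<eta>"
      by (rule cstar_norm_le[rotated]) (use assms in simp)
    then have close: "norm (e' - r) < \<eta>" using assms by linarith

    have unit: "x * e' = e'" if "x * e = e" for x
    proof -
      have "x * m = m" by (simp add: m_def that flip: mult.assoc)
      \<comment> \<open>A further factor t splits off from \<open>g\<close> because of the cutoff.
        Thus \<open>b\<close> begins with \<open>m\<close>, hence with \<open>e\<close>, and a left
        unit for \<open>e\<close> is one for \<open>b\<close>.\<close>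
      moreover have "b = m * cfc m (\<lambda>t. sqrt (sqrt (sqrt (max t 0))) / (max t k * max t k) * cutoff k t) m"
      proof -
        let ?g = "\<lambda>t. sqrt (sqrt (sqrt (max t 0))) / (max t k * max t k) * cutoff k t"
        have "continuous_on {-1..1} ?g"
          using k by (intro continuous_intros continuous_on_cutoff) auto
        then have "m * cfc m ?g m = cfc m (\<lambda>t. t * ?g t) m"
          using cfc_mult[OF m continuous_on_id, of ?g m] by (simp only: cfc_id[OF m])
        also have "(\<lambda>t. t * ?g t) = g"
        proof
          fix t show "t * ?g t = g t"
            using k by (cases "t \<le> k") (simp_all add: g_def eighth_root_quot_def cutoff_eq_0)
        qed
        finally show ?thesis by (simp add: b_def)
      qed
      ultimately have "x * b = b" by (metis mult.assoc)
      then show ?thesis by (simp add: e'_def flip: mult.assoc)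
    qed

    have w_mult: "w * x = e * cfc m h x" for x
      by (simp add: w_def cfc_adj[OF m ch] adjs)
    have w_adj: "adj w * x = cfc m h (e * x)" for x
      by (simp add: w_def adj_adj cfc_mult_right[OF m ch])
    have edde: "e * (d * (d * (e * y))) = m * y" for y
      by (simp only: m_def mult.assoc)
    have hmh: "adj w * d * d * w * x = cfc m (\<lambda>t. h t * (t * h t)) x" for x
    proof -
      have "adj w * d * d * w * x = adj w * (d * (d * (w * x)))"
        by (simp only: mult.assoc)
      also have "\<dots> = cfc m h (e * (d * (d * (e * cfc m h x))))"
        by (simp only: w_mult w_adj)
      also have "\<dots> = cfc m h (cfc m (\<lambda>t. t) (cfc m h x))"
        by (simp only: cfc_id[OF m] edde)
      also have "\<dots> = cfc m (\<lambda>t. h t * (t * h t)) x"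
        using cfc_mult[OF m continuous_on_id ch, of x] cfc_mult[OF m ch, of "\<lambda>t. t * h t" x]
        by (simp add: continuous_on_mult continuous_on_id ch)
      finally show ?thesis .
    qed
    have chh: "continuous_on {-1..1} (\<lambda>t. h t * (t * h t))"
      by (intro continuous_intros ch)
    have "adj w * d * d * w * b = b"
      unfolding hmh unfolding b_def cfc_mult[OF m chh cg]
      by (simp only: h_def g_def inv_sqrt_square_eighth_root_quot[OF k])
    then have wdw: "adj w * d * d * w * e' = e'"
      by (simp add: e'_def flip: mult.assoc)

    \<comment> \<open>The square of the operator \<open>d * w\<close> is h(m) m h(m), a function
      bounded by 1. Shrinking the local unit later therefore does not enlarge errors.\<close>
    have dw_le: "norm (d * w * x) \<le> norm x" for x
    proof -
      have "(norm (d * w * x))\<^sup>2 = norm (adj (d * w * x) * (d * w * x))"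
        by (simp only: cstar_identity)
      also have "adj (d * w * x) * (d * w * x) = adj x * (adj w * d * d * w * x)"
        by (simp add: adj_mult adjs mult.assoc)
      also have "norm \<dots> \<le> norm x * norm (adj w * d * d * w * x)"
        using norm_mult_ineq[of "adj x"] by simp
      also have "\<dots> \<le> norm x * (1 * norm x)"
        unfolding hmh h_def
        using inv_sqrt_square_le[OF k] chh[unfolded h_def] by (intro mult_left_mono cfc_bound[OF m]) auto
      finally have "(norm (d * w * x))\<^sup>2 \<le> (norm x)\<^sup>2"
        by (simp add: power2_eq_square)
      then show ?thesis
        by (rule power2_le_imp_le) simp
    qed

    have "norm ((d * w * e' - r) * x) \<le> 7 / 8 * \<eta> * norm x" for x
    proof -
      have "d * w * e' * x = d * (w * (e' * x))"
        by (simp only: mult.assoc)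
      also have "\<dots> = d * (e * cfc m h (cfc m f x))"
        by (simp only: w_mult e'_mult)
      finally have "d * w * e' * x = d * e * cfc m q x"
        by (simp only: cfc_mult[OF m ch cf] mult.assoc flip: q_def)
      \<comment> \<open>Three sources of error: \<open>d * e\<close> against s^4, \<open>m\<close>
        against s^8, and the cutoff.\<close>
      then have "(d * w * e' - r) * x = (d * e - r * r) * cfc m q x
          + (r * r) * (cfc m q x - cfc m' q x) + (r * (r * cfc m' q x) - r * x)"
        by (simp add: algebra_simps)
      moreover have "norm ((d * e - r * r) * cfc m q x) \<le> \<eta> / 8 * norm x"
      proof -
        have "norm ((d * e - r * r) * cfc m q x) \<le> norm (d * e - r * r) * norm (cfc m q x)"
          by (rule norm_mult_ineq)
        also have "\<dots> \<le> 2 * (\<eta> / (16 * (K + 1))) * (K * norm x)"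
          using de(1) K assms by (intro mult_mono cfc_bound[OF m cq]) (auto simp: \<delta>_def)
        also have "\<dots> = \<eta> / 8 * (K / (K + 1)) * norm x"
          using K by (simp add: field_simps)
        also have "\<dots> \<le> \<eta> / 8 * 1 * norm x"
          using K assms by (intro mult_right_mono mult_left_mono) auto
        finally show ?thesis by simp
      qed
      moreover have "norm ((r * r) * (cfc m q x - cfc m' q x)) \<le> \<eta> / 8 * norm x"
        using \<delta>2(2)[OF m m' mm'(2), of x] norm_mult_le_contraction(1)[OF nrr(1), of "cfc m q x - cfc m' q x"]
        by linarith
      moreover have "norm (r * (r * cfc m' q x) - r * x) \<le> \<eta> / 2 * norm x"
      proof -
        have "continuous_on {-1..1} (\<lambda>t::real. t ^ 4)" by (intro continuous_intros)
        then have "r * (r * cfc m' q x) = cfc s (\<lambda>t. t ^ 4 * q (t ^ 8)) x"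
          by (simp only: cfc_rr comp[OF cq] cfc_mult[OF s _ c8[OF cq]])
        moreover have "(\<lambda>t. t ^ 4 * q (t ^ 8)) = (\<lambda>t. t\<^sup>2 * (cutoff k (t ^ 8))\<^sup>2)"
          by (simp only: q_def h_def f_def inv_sqrt_quartic_root_cut_power8[OF k])
        ultimately show ?thesis
          using limit[of x] by (simp only:)
      qed
      ultimately have "norm ((d * w * e' - r) * x) \<le> \<eta> / 8 * norm x + \<eta> / 8 * norm x + \<eta> / 2 * norm x"
        by (simp only:) (intro norm_triangle_le add_mono; assumption)
      moreover have "0 \<le> \<eta> * norm x" using assms by simp
      ultimately show ?thesis by simp
    qed
    then have "norm (d * w * e' - r) \<le> 7 / 8 * \<eta>"
      by (rule cstar_norm_le[rotated]) (use assms in simp)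
    then have "norm (d * w * e' - r) < \<eta>" using assms by linarith
    then show ?thesis
      using pos norm_e' close unit wdw dw_le unfolding r_def by blast
  qed
  ultimately show ?thesis by blast
qed

text \<open>The new index is treated first and the induction hypothesis is applied to the resulting
  \<open>e'\<close>, so tolerances are chosen in reverse order. Left units of \<open>e'\<close> are
  left units of the final \<open>a\<close>, which keeps the equation for the new index
  exact.\<close>

lemma common_local_unit:
  assumes "finite I" "0 < \<eta>"
  shows "\<exists>\<delta>>0. \<forall>(s::'a::cstar_algebra) e d.
    sa_contraction s \<longrightarrow> cstar_positive e \<longrightarrow> norm e \<le> 1 \<longrightarrow> norm (e - s * s) < \<delta> \<longrightarrow>
    (\<forall>i\<in>I. sa_contraction (d i) \<and> norm (d i - s * s) < \<delta>) \<longrightarrow>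
    (\<exists>a w. cstar_positive a \<and> norm a \<le> 1 \<and> norm (a - s * s) < \<eta> \<and>
       (\<forall>x. x * e = e \<longrightarrow> x * a = a) \<and>
       (\<forall>i\<in>I. adj (w i) * d i * d i * w i * a = a \<and> norm (d i * w i * a - s * s) < \<eta>))"
  using assms
proof (induction I arbitrary: \<eta> rule: finite_induct)
  case empty
  then show ?case by (intro exI[of _ \<eta>]) auto
next
  case (insert j I)
  have "\<eta> / 4 > 0" using insert.prems by simp
  from insert.IH[OF this] obtain \<delta>1 where "\<delta>1 > 0" and \<delta>1: "\<And>(s::'a) e d.
    \<lbrakk>sa_contraction s; cstar_positive e; norm e \<le> 1; norm (e - s * s) < \<delta>1;
     \<forall>i\<in>I. sa_contraction (d i) \<and> norm (d i - s * s) < \<delta>1\<rbrakk> \<Longrightarrow>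
    \<exists>a w. cstar_positive a \<and> norm a \<le> 1 \<and> norm (a - s * s) < \<eta> / 4 \<and>
       (\<forall>x. x * e = e \<longrightarrow> x * a = a) \<and>
       (\<forall>i\<in>I. adj (w i) * d i * d i * w i * a = a \<and> norm (d i * w i * a - s * s) < \<eta> / 4)"
    by (elim exE conjE) (rule that, assumption, blast)
  define \<eta>1 where "\<eta>1 = min (\<eta> / 4) \<delta>1"
  have "\<eta>1 \<le> \<eta> / 4" by (simp add: \<eta>1_def)
  have "\<eta>1 > 0" using \<open>\<eta> / 4 > 0\<close> \<open>\<delta>1 > 0\<close> by (simp add: \<eta>1_def)
  from local_unit_step[OF this, where 'a = 'a] obtain \<delta>2 where "\<delta>2 > 0" and \<delta>2: "\<And>s d e :: 'a.
    \<lbrakk>sa_contraction s; sa_contraction d; cstar_positive e; norm e \<le> 1;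
     norm (d - s * s) < \<delta>2; norm (e - s * s) < \<delta>2\<rbrakk> \<Longrightarrow>
    \<exists>e' w. cstar_positive e' \<and> norm e' \<le> 1 \<and> norm (e' - s * s) < \<eta>1 \<and>
       (\<forall>x. x * e = e \<longrightarrow> x * e' = e') \<and> adj w * d * d * w * e' = e' \<and>
       (\<forall>x. norm (d * w * x) \<le> norm x) \<and> norm (d * w * e' - s * s) < \<eta>1"
    by (elim exE conjE) (rule that, assumption, blast)
  show ?case
  proof (intro exI[of _ "min \<delta>1 \<delta>2"] conjI allI impI)
    show "min \<delta>1 \<delta>2 > 0" using \<open>\<delta>1 > 0\<close> \<open>\<delta>2 > 0\<close> by simp
    fix s e :: 'a and d
    assume s: "sa_contraction s" and e: "cstar_positive e" "norm e \<le> 1" "norm (e - s * s) < min \<delta>1 \<delta>2"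
      and d: "\<forall>i\<in>insert j I. sa_contraction (d i) \<and> norm (d i - s * s) < min \<delta>1 \<delta>2"
    obtain e' v where e': "cstar_positive e'" "norm e' \<le> 1" "norm (e' - s * s) < \<eta>1"
      "\<And>x. x * e = e \<Longrightarrow> x * e' = e'" and v: "adj v * d j * d j * v * e' = e'"
       "\<And>x. norm (d j * v * x) \<le> norm x" "norm (d j * v * e' - s * s) < \<eta>1"
      using \<delta>2[OF s, of "d j" e] d e by auto
    have "norm (e' - s * s) < \<delta>1" "\<forall>i\<in>I. sa_contraction (d i) \<and> norm (d i - s * s) < \<delta>1"
      using e'(3) d by (auto simp: \<eta>1_def)
    from \<delta>1[OF s e'(1,2) this] obtain a w where aw:
       "cstar_positive a \<and> norm a \<le> 1 \<and> norm (a - s * s) < \<eta> / 4 \<and>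
        (\<forall>x. x * e' = e' \<longrightarrow> x * a = a) \<and>
        (\<forall>i\<in>I. adj (w i) * d i * d i * w i * a = a \<and> norm (d i * w i * a - s * s) < \<eta> / 4)"
      by (elim exE)
    then have a: "cstar_positive a" "norm a \<le> 1" "norm (a - s * s) < \<eta> / 4"
      "\<And>x. x * e' = e' \<Longrightarrow> x * a = a"
      and w: "\<And>i. i \<in> I \<Longrightarrow> adj (w i) * d i * d i * w i * a = a \<and> norm (d i * w i * a - s * s) < \<eta> / 4"
      by blast+
    \<comment> \<open>By contractivity, replacing \<open>e'\<close> by \<open>a\<close> costs less
      than \<eta>/2 on top of \<eta>/4.\<close>
    have "norm (d j * v * a - s * s) < \<eta>"
    proof -
      have "norm (d j * v * (a - e')) \<le> norm (a - e')" by (rule v(2))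
      moreover have "norm (a - e') \<le> norm (a - s * s) + norm (e' - s * s)"
        using norm_triangle_ineq4[of "a - s * s" "e' - s * s"] by simp
      moreover have "norm (d j * v * a - s * s) \<le> norm (d j * v * (a - e')) + norm (d j * v * e' - s * s)"
        using norm_triangle_ineq[of "d j * v * (a - e')" "d j * v * e' - s * s"]
        by (simp add: right_diff_distrib)
      ultimately show ?thesis using a(3) e'(3) v(3) \<open>\<eta>1 \<le> \<eta> / 4\<close> \<open>\<eta> / 4 > 0\<close> by linarith
    qed
    moreover have "adj v * d j * d j * v * a = a" using a(4) v(1) by blast
    ultimately have "\<forall>i\<in>insert j I. adj ((w(j := v)) i) * d i * d i * (w(j := v)) i * a = a
        \<and> norm (d i * (w(j := v)) i * a - s * s) < \<eta>"
      using w insert.hyps insert.prems by fastforce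
    moreover have "\<forall>x. x * e = e \<longrightarrow> x * a = a" using a(4) e'(4) by blast
    moreover have "norm (a - s * s) < \<eta>" using a(3) insert.prems by linarith
    ultimately show "\<exists>a w. cstar_positive a \<and> norm a \<le> 1 \<and> norm (a - s * s) < \<eta> \<and>
       (\<forall>x. x * e = e \<longrightarrow> x * a = a) \<and>
       (\<forall>i\<in>insert j I. adj (w i) * d i * d i * w i * a = a \<and> norm (d i * w i * a - s * s) < \<eta>)"
      using a(1,2) by blast
  qed
qed

section \<open>Homomorphisms into the crossed product\<close>

text \<open>Shows that the supremum in \<open>crossed_norm\<close> is over a nonempty set, and
  bounds it below by 0.\<close>

lemma crossed_cstar_seminorm_zero: "crossed_cstar_seminorm G \<alpha> (\<lambda>_. 0)"
  by (simp add: crossed_cstar_seminorm_def crossed_l1_norm_def sum_nonneg)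

lemma crossed_norm_le_l1_norm:
  assumes "x \<in> crossed_carrier G"
  shows "crossed_norm G \<alpha> x \<le> crossed_l1_norm G x"
  unfolding crossed_norm_def
proof (rule cSUP_least)
  show "{p. crossed_cstar_seminorm G \<alpha> p} \<noteq> {}"
    using crossed_cstar_seminorm_zero by blast
qed (use assms in \<open>simp add: crossed_cstar_seminorm_def\<close>)

lemma crossed_norm_nonneg:
  assumes "x \<in> crossed_carrier G"
  shows "0 \<le> crossed_norm G \<alpha> x"
  unfolding crossed_norm_def
proof (rule cSUP_upper2[where x = "\<lambda>_. 0"])
  show "bdd_above ((\<lambda>p. p x) ` {p. crossed_cstar_seminorm G \<alpha> p})"
    using assms by (intro bdd_aboveI2[where M = "crossed_l1_norm G x"]) (auto simp: crossed_cstar_seminorm_def)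
qed (use crossed_cstar_seminorm_zero in auto)

lemma crossed_diff_carrier: "crossed_diff G x y \<in> crossed_carrier G"
  by (simp add: crossed_diff_def crossed_carrier_def)

text \<open>The infimum is taken in the reals, so nonnegativity of the norm is what allows a single
  near point to bound it.\<close>

lemma crossed_dist_less:
  assumes "y \<in> S" "crossed_l1_norm G (crossed_diff G x y) < \<epsilon>"
  shows "crossed_dist G \<alpha> x S < \<epsilon>"
proof -
  have "crossed_dist G \<alpha> x S \<le> crossed_norm G \<alpha> (crossed_diff G x y)"
    unfolding crossed_dist_def using assms(1)
    by (intro cINF_lower bdd_belowI2[where m = 0] crossed_norm_nonneg crossed_diff_carrier)
  also have "\<dots> \<le> crossed_l1_norm G (crossed_diff G x y)"
    by (rule crossed_norm_le_l1_norm[OF crossed_diff_carrier])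
  finally show ?thesis using assms(2) by simp
qed

locale finite_cstar_action = group G for G :: "('g, 'm) monoid_scheme" (structure) +
  fixes \<alpha> :: "'g \<Rightarrow> 'a::cstar_algebra \<Rightarrow> 'a"
  assumes finite_carrier: "finite (carrier G)" and action: "cstar_action G \<alpha>"
begin

lemma automorphism: "g \<in> carrier G \<Longrightarrow> star_automorphism (\<alpha> g)"
  using action by (simp add: cstar_action_def)

lemma \<alpha>_add: "g \<in> carrier G \<Longrightarrow> \<alpha> g (x + y) = \<alpha> g x + \<alpha> g y"
  and \<alpha>_mult: "g \<in> carrier G \<Longrightarrow> \<alpha> g (x * y) = \<alpha> g x * \<alpha> g y"
  and \<alpha>_adj: "g \<in> carrier G \<Longrightarrow> \<alpha> g (adj x) = adj (\<alpha> g x)"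
  and \<alpha>_scaleC: "g \<in> carrier G \<Longrightarrow> \<alpha> g (scaleC c x) = scaleC c (\<alpha> g x)"
  using automorphism by (auto simp: star_automorphism_def)

lemma norm_\<alpha>_le: "g \<in> carrier G \<Longrightarrow> norm (\<alpha> g x) \<le> norm x"
  by (rule star_automorphism_norm_le[OF automorphism])

lemma \<alpha>_zero: "g \<in> carrier G \<Longrightarrow> \<alpha> g 0 = 0"
  using \<alpha>_add[of g 0 0] by simp

lemma \<alpha>_diff: "g \<in> carrier G \<Longrightarrow> \<alpha> g (x - y) = \<alpha> g x - \<alpha> g y"
  using \<alpha>_add[of g "x - y" y] by simp

lemma \<alpha>_sum: "g \<in> carrier G \<Longrightarrow> \<alpha> g (\<Sum>i\<in>I. f i) = (\<Sum>i\<in>I. \<alpha> g (f i))"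
  by (induction I rule: infinite_finite_induct) (auto simp: \<alpha>_zero \<alpha>_add)

lemma \<alpha>_\<alpha>: "g \<in> carrier G \<Longrightarrow> h \<in> carrier G \<Longrightarrow> \<alpha> g (\<alpha> h x) = \<alpha> (g \<otimes> h) x"
  using action by (simp add: cstar_action_def)

lemma \<alpha>_one: "\<alpha> \<one> x = x"
proof -
  have "\<alpha> \<one> (\<alpha> \<one> x) = \<alpha> \<one> x" by (simp add: \<alpha>_\<alpha>)
  moreover have "inj (\<alpha> \<one>)"
    using automorphism[of \<one>] by (simp add: star_automorphism_def bij_is_inj)
  ultimately show ?thesis by (simp add: inj_eq)
qed

lemma inv_mult_cancel: "\<lbrakk>g \<in> carrier G; h \<in> carrier G\<rbrakk> \<Longrightarrow> inv g \<otimes> (g \<otimes> h) = h"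
  and mult_inv_cancel: "\<lbrakk>g \<in> carrier G; h \<in> carrier G\<rbrakk> \<Longrightarrow> g \<otimes> (inv g \<otimes> h) = h"
  by (simp_all flip: m_assoc)

lemma sum_inv_mult:
  assumes "g \<in> carrier G"
  shows "(\<Sum>l\<in>carrier G. f (inv l \<otimes> g)) = (\<Sum>p\<in>carrier G. f p)"
  by (rule sum.reindex_bij_witness[where i = "\<lambda>p. g \<otimes> inv p" and j = "\<lambda>l. inv l \<otimes> g"])
    (use assms in \<open>auto simp: inv_mult_group m_assoc mult_inv_cancel\<close>)

lemma sum_left_translate:
  assumes "k \<in> carrier G"
  shows "(\<Sum>g\<in>carrier G. f (k \<otimes> g)) = (\<Sum>g\<in>carrier G. f g)"
  by (rule sum.reindex_bij_witness[where i = "\<lambda>g. inv k \<otimes> g" and j = "\<lambda>g. k \<otimes> g"])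
    (use assms in \<open>auto simp: inv_mult_cancel mult_inv_cancel\<close>)

text \<open>The coefficients of \<open>\<Sum> v\<^sub>g M\<^sub>g\<^sub>h v\<^sub>h\<^sup>*\<close> for \<open>v\<^sub>g = c(g) u\<^sub>g\<close>, where \<open>\<gamma>\<close> numbers the group
  elements.\<close>

definition matrix_map :: "('g \<Rightarrow> 'a) \<Rightarrow> ('g \<Rightarrow> nat) \<Rightarrow> 'a mat \<Rightarrow> 'g \<Rightarrow> 'a" where
  "matrix_map c \<gamma> M = (\<lambda>k\<in>carrier G. \<Sum>g\<in>carrier G.
     c g * \<alpha> g (M $$ (\<gamma> g, \<gamma> (inv k \<otimes> g))) * \<alpha> k (adj (c (inv k \<otimes> g))))"

text \<open>In the convolution, orthogonality lets the adjoint of v_p meet only v_p itself, so the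
  sum over the group becomes the sum over the inner matrix index. The product left in the middle is
  absorbed by the entries of \<open>N\<close>.\<close>

lemma matrix_map_mult:
  assumes \<gamma>: "bij_betw \<gamma> (carrier G) {..<n}"
    and M: "M \<in> carrier_mat n n" and N: "N \<in> carrier_mat n n"
    and orth: "\<And>g h. \<lbrakk>g \<in> carrier G; h \<in> carrier G; g \<noteq> h\<rbrakk> \<Longrightarrow> adj (c g) * c h = 0"
    and unit: "\<And>p i j. \<lbrakk>p \<in> carrier G; i < n; j < n\<rbrakk> \<Longrightarrow> \<alpha> (inv p) (adj (c p) * c p) * N $$ (i, j) = N $$ (i, j)"
  shows "matrix_map c \<gamma> (M * N) = crossed_mult G \<alpha> (matrix_map c \<gamma> M) (matrix_map c \<gamma> N)"
proof -
  have \<gamma>_less: "\<gamma> g < n" if "g \<in> carrier G" for g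
    using \<gamma> that by (auto simp: bij_betw_def)
  define T where "T k g p = c g * \<alpha> g (M $$ (\<gamma> g, \<gamma> p) * N $$ (\<gamma> p, \<gamma> (inv k \<otimes> g))) * \<alpha> k (adj (c (inv k \<otimes> g)))"
    for k g p
  have left: "matrix_map c \<gamma> (M * N) k = (\<Sum>g\<in>carrier G. \<Sum>p\<in>carrier G. T k g p)" if k: "k \<in> carrier G" for k
  proof -
    have "(M * N) $$ (\<gamma> g, \<gamma> q) = (\<Sum>p\<in>carrier G. M $$ (\<gamma> g, \<gamma> p) * N $$ (\<gamma> p, \<gamma> q))"
      if "g \<in> carrier G" "q \<in> carrier G" for g q
    proof -
      have "(M * N) $$ (\<gamma> g, \<gamma> q) = (\<Sum>i\<in>{..<n}. M $$ (\<gamma> g, i) * N $$ (i, \<gamma> q))"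
        using M N \<gamma>_less[OF that(1)] \<gamma>_less[OF that(2)]
        by (simp add: scalar_prod_def lessThan_atLeast0)
      also have "\<dots> = (\<Sum>p\<in>carrier G. M $$ (\<gamma> g, \<gamma> p) * N $$ (\<gamma> p, \<gamma> q))"
        by (rule sum.reindex_bij_betw[OF \<gamma>, symmetric])
      finally show ?thesis .
    qed
    then show ?thesis
      using k by (simp add: matrix_map_def T_def \<alpha>_sum sum_distrib_left sum_distrib_right)
  qed
  \<comment> \<open>The inner index is \<open>inv l \<otimes> g\<close>: the first factor at
    \<open>l\<close> pairs it with \<open>g\<close>, and orthogonality selects it from the second
    factor.\<close>
  have summand: "(c g * \<alpha> g (M $$ (\<gamma> g, \<gamma> (inv l \<otimes> g))) * \<alpha> l (adj (c (inv l \<otimes> g))))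
      * \<alpha> l (matrix_map c \<gamma> N (inv l \<otimes> k)) = T k g (inv l \<otimes> g)"
    if k: "k \<in> carrier G" and l: "l \<in> carrier G" and g: "g \<in> carrier G" for k l g
  proof -
    let ?p = "inv l \<otimes> g" and ?q = "inv k \<otimes> g"
    have p: "?p \<in> carrier G" and q: "?q \<in> carrier G" using k l g by auto
    define D where "D h = \<alpha> h (N $$ (\<gamma> h, \<gamma> (inv (inv l \<otimes> k) \<otimes> h))) * \<alpha> (inv l \<otimes> k) (adj (c (inv (inv l \<otimes> k) \<otimes> h)))"
      for h
    have "adj (c ?p) * matrix_map c \<gamma> N (inv l \<otimes> k) = (\<Sum>h\<in>carrier G. adj (c ?p) * c h * D h)"
      using k l by (simp add: matrix_map_def D_def sum_distrib_left mult.assoc)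
    also have "\<dots> = (\<Sum>h\<in>carrier G. if h = ?p then adj (c ?p) * c ?p * D ?p else 0)"
      using orth[OF p] by (intro sum.cong) auto
    also have "\<dots> = adj (c ?p) * c ?p * D ?p"
      using p finite_carrier by simp
    finally have "adj (c ?p) * matrix_map c \<gamma> N (inv l \<otimes> k) = adj (c ?p) * c ?p * D ?p" .
    then have "\<alpha> l (adj (c ?p)) * \<alpha> l (matrix_map c \<gamma> N (inv l \<otimes> k)) = \<alpha> l (adj (c ?p) * c ?p) * \<alpha> l (D ?p)"
      by (metis \<alpha>_mult l)
    moreover have "\<alpha> l (adj (c ?p) * c ?p) = \<alpha> g (\<alpha> (inv ?p) (adj (c ?p) * c ?p))"
    proof -
      have "g \<otimes> inv ?p = l" using g l by (simp add: inv_mult_group mult_inv_cancel)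
      then show ?thesis using g p by (simp add: \<alpha>_\<alpha>)
    qed
    moreover have "\<alpha> l (D ?p) = \<alpha> g (N $$ (\<gamma> ?p, \<gamma> ?q)) * \<alpha> k (adj (c ?q))"
    proof -
      have "inv (inv l \<otimes> k) \<otimes> ?p = ?q"
        using k l g by (simp add: inv_mult_group m_assoc mult_inv_cancel)
      moreover have "l \<otimes> ?p = g" "l \<otimes> (inv l \<otimes> k) = k"
        using k l g by (simp_all add: mult_inv_cancel)
      ultimately show ?thesis
        using l p k by (simp add: D_def \<alpha>_mult \<alpha>_\<alpha>)
    qed
    moreover have "\<alpha> g (\<alpha> (inv ?p) (adj (c ?p) * c ?p)) * \<alpha> g (N $$ (\<gamma> ?p, \<gamma> ?q)) = \<alpha> g (N $$ (\<gamma> ?p, \<gamma> ?q))"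
      using unit[OF p \<gamma>_less[OF p] \<gamma>_less[OF q]] g by (simp flip: \<alpha>_mult)
    ultimately have *: "\<alpha> l (adj (c ?p)) * \<alpha> l (matrix_map c \<gamma> N (inv l \<otimes> k)) = \<alpha> g (N $$ (\<gamma> ?p, \<gamma> ?q)) * \<alpha> k (adj (c ?q))"
      by (simp only: mult.assoc[symmetric])
    show ?thesis
      using g by (simp only: T_def mult.assoc *) (simp only: \<alpha>_mult mult.assoc)
  qed
  have right: "crossed_mult G \<alpha> (matrix_map c \<gamma> M) (matrix_map c \<gamma> N) k = (\<Sum>g\<in>carrier G. \<Sum>p\<in>carrier G. T k g p)"
    if k: "k \<in> carrier G" for k
  proof -
    have "crossed_mult G \<alpha> (matrix_map c \<gamma> M) (matrix_map c \<gamma> N) k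
      = (\<Sum>l\<in>carrier G. matrix_map c \<gamma> M l * \<alpha> l (matrix_map c \<gamma> N (inv l \<otimes> k)))"
      using k by (simp add: crossed_mult_def)
    also have "\<dots> = (\<Sum>l\<in>carrier G. \<Sum>g\<in>carrier G. T k g (inv l \<otimes> g))"
    proof (rule sum.cong[OF refl])
      fix l assume l: "l \<in> carrier G"
      have "matrix_map c \<gamma> M l * \<alpha> l (matrix_map c \<gamma> N (inv l \<otimes> k))
        = (\<Sum>g\<in>carrier G. (c g * \<alpha> g (M $$ (\<gamma> g, \<gamma> (inv l \<otimes> g))) * \<alpha> l (adj (c (inv l \<otimes> g))))
            * \<alpha> l (matrix_map c \<gamma> N (inv l \<otimes> k)))"
        using l by (simp only: matrix_map_def[of c \<gamma> M] restrict_apply' sum_distrib_right)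
      also have "\<dots> = (\<Sum>g\<in>carrier G. T k g (inv l \<otimes> g))"
        by (rule sum.cong[OF refl]) (rule summand[OF k l])
      finally show "matrix_map c \<gamma> M l * \<alpha> l (matrix_map c \<gamma> N (inv l \<otimes> k)) = (\<Sum>g\<in>carrier G. T k g (inv l \<otimes> g))" .
    qed
    also have "\<dots> = (\<Sum>g\<in>carrier G. \<Sum>l\<in>carrier G. T k g (inv l \<otimes> g))"
      by (rule sum.swap)
    also have "\<dots> = (\<Sum>g\<in>carrier G. \<Sum>p\<in>carrier G. T k g p)"
      by (rule sum.cong[OF refl]) (rule sum_inv_mult)
    finally show ?thesis .
  qed
  show ?thesis
  proof
    fix k
    show "matrix_map c \<gamma> (M * N) k = crossed_mult G \<alpha> (matrix_map c \<gamma> M) (matrix_map c \<gamma> N) k"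
    proof (cases "k \<in> carrier G")
      case True
      then show ?thesis by (simp only: left right)
    next
      case False
      then show ?thesis by (simp add: matrix_map_def crossed_mult_def)
    qed
  qed
qed

lemma matrix_map_adj:
  assumes \<gamma>: "bij_betw \<gamma> (carrier G) {..<n}" and M: "M \<in> carrier_mat n n"
  shows "matrix_map c \<gamma> (mat_adj M) = crossed_adj G \<alpha> (matrix_map c \<gamma> M)"
proof
  have \<gamma>_less: "\<gamma> g < n" if "g \<in> carrier G" for g
    using \<gamma> that by (auto simp: bij_betw_def)
  fix k
  show "matrix_map c \<gamma> (mat_adj M) k = crossed_adj G \<alpha> (matrix_map c \<gamma> M) k"
  proof (cases "k \<in> carrier G")
    case k: True
    define T where "T g = c g * \<alpha> g (adj (M $$ (\<gamma> (inv k \<otimes> g), \<gamma> g))) * \<alpha> k (adj (c (inv k \<otimes> g)))" for g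
    have "mat_adj M $$ (\<gamma> g, \<gamma> (inv k \<otimes> g)) = adj (M $$ (\<gamma> (inv k \<otimes> g), \<gamma> g))" if "g \<in> carrier G" for g
      using M k that by (simp add: mat_adj_def \<gamma>_less)
    then have "matrix_map c \<gamma> (mat_adj M) k = (\<Sum>g\<in>carrier G. T g)"
      using k by (simp add: matrix_map_def T_def)
    also have "\<dots> = (\<Sum>g\<in>carrier G. T (k \<otimes> g))"
      by (rule sum_left_translate[OF k, symmetric])
    also have "\<dots> = (\<Sum>g\<in>carrier G. \<alpha> k (adj (c g * \<alpha> g (M $$ (\<gamma> g, \<gamma> (inv (inv k) \<otimes> g))) * \<alpha> (inv k) (adj (c (inv (inv k) \<otimes> g))))))"
      using k by (intro sum.cong) (simp_all add: T_def inv_mult_cancel adj_mult adj_adj \<alpha>_mult \<alpha>_\<alpha> \<alpha>_one mult.assoc flip: \<alpha>_adj)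
    also have "\<dots> = crossed_adj G \<alpha> (matrix_map c \<gamma> M) k"
      using k by (simp add: crossed_adj_def matrix_map_def \<alpha>_sum adj_sum)
    finally show ?thesis .
  qed (simp add: matrix_map_def crossed_adj_def)
qed

lemma matrix_star_hom_matrix_map:
  assumes \<gamma>: "bij_betw \<gamma> (carrier G) {..<n}"
    and orth: "\<And>g h. \<lbrakk>g \<in> carrier G; h \<in> carrier G; g \<noteq> h\<rbrakk> \<Longrightarrow> adj (c g) * c h = 0"
    and unit: "\<And>p b. \<lbrakk>p \<in> carrier G; b \<in> B\<rbrakk> \<Longrightarrow> \<alpha> (inv p) (adj (c p) * c p) * b = b"
  shows "matrix_star_hom G \<alpha> n B (matrix_map c \<gamma>)"
proof -
  have \<gamma>_less: "\<gamma> g < n" if "g \<in> carrier G" for g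
    using \<gamma> that by (auto simp: bij_betw_def)
  have mat: "M \<in> carrier_mat n n" if "M \<in> matrices_over n B" for M
    using that by (simp add: matrices_over_def)
  have entry: "M $$ (i, j) \<in> B" if "M \<in> matrices_over n B" "i < n" "j < n" for M i j
    using that by (auto simp: matrices_over_def intro: elements_matI)
  show ?thesis
    unfolding matrix_star_hom_def
  proof (intro conjI ballI allI)
    fix M assume M: "M \<in> matrices_over n B"
    show "matrix_map c \<gamma> M \<in> crossed_carrier G"
      by (simp add: matrix_map_def crossed_carrier_def)
    show "matrix_map c \<gamma> (mat_adj M) = crossed_adj G \<alpha> (matrix_map c \<gamma> M)"
      by (rule matrix_map_adj[OF \<gamma> mat[OF M]])
    show "matrix_map c \<gamma> (mat_scaleC z M) = crossed_scaleC G z (matrix_map c \<gamma> M)" for z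
      using mat[OF M] unfolding matrix_map_def crossed_scaleC_def
      by (intro restrict_ext) (simp add: mat_scaleC_def \<gamma>_less \<alpha>_scaleC mult_scaleC_left mult_scaleC_right scaleC_sum)
    fix N assume N: "N \<in> matrices_over n B"
    show "matrix_map c \<gamma> (M + N) = crossed_add G (matrix_map c \<gamma> M) (matrix_map c \<gamma> N)"
      using mat[OF M] mat[OF N] unfolding matrix_map_def crossed_add_def
      by (intro restrict_ext) (simp add: \<gamma>_less \<alpha>_add distrib_left distrib_right sum.distrib)
    show "matrix_map c \<gamma> (M * N) = crossed_mult G \<alpha> (matrix_map c \<gamma> M) (matrix_map c \<gamma> N)"
      by (intro matrix_map_mult[OF \<gamma> mat[OF M] mat[OF N]] orth unit entry[OF N])
  qed
qed

text \<open>The entry is the coefficient at the identity of \<open>adj u_g * x * u_h\<close>,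
  compressed by \<open>a\<close>. With q_g = c(g) \<alpha>_g(a), the image then has the coefficients
  of the sum of q_g x_k u_k (adj q_h) over g = k h.\<close>

lemma matrix_map_compression:
  assumes \<gamma>: "bij_betw \<gamma> (carrier G) {..<n}" and a: "adj a = a" and k: "k \<in> carrier G"
    and M: "\<And>g h. \<lbrakk>g \<in> carrier G; h \<in> carrier G\<rbrakk> \<Longrightarrow> M $$ (\<gamma> g, \<gamma> h) = a * \<alpha> (inv g) (x (g \<otimes> inv h)) * a"
  shows "matrix_map c \<gamma> M k = (\<Sum>g\<in>carrier G.
    (c g * \<alpha> g a) * x k * \<alpha> k (adj (c (inv k \<otimes> g) * \<alpha> (inv k \<otimes> g) a)))"
proof -
  have "c g * \<alpha> g (M $$ (\<gamma> g, \<gamma> (inv k \<otimes> g))) * \<alpha> k (adj (c (inv k \<otimes> g)))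
      = (c g * \<alpha> g a) * x k * \<alpha> k (adj (c (inv k \<otimes> g) * \<alpha> (inv k \<otimes> g) a))" if g: "g \<in> carrier G" for g
  proof -
    have "g \<otimes> inv (inv k \<otimes> g) = k" using g k by (simp add: inv_mult_group mult_inv_cancel)
    then have "\<alpha> g (M $$ (\<gamma> g, \<gamma> (inv k \<otimes> g))) = \<alpha> g a * x k * \<alpha> g a"
      using g k by (simp add: M \<alpha>_mult \<alpha>_\<alpha> \<alpha>_one)
    moreover have "\<alpha> k (adj (c (inv k \<otimes> g) * \<alpha> (inv k \<otimes> g) a)) = \<alpha> g a * \<alpha> k (adj (c (inv k \<otimes> g)))"
    proof -
      have "adj (\<alpha> (inv k \<otimes> g) a) = \<alpha> (inv k \<otimes> g) a"
        using g k by (simp add: a flip: \<alpha>_adj)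
      then show ?thesis
        using g k by (simp add: adj_mult \<alpha>_mult \<alpha>_\<alpha> mult_inv_cancel)
    qed
    ultimately show ?thesis by (simp only: mult.assoc)
  qed
  then show ?thesis using k by (simp add: matrix_map_def)
qed

end

section \<open>Rokhlin approximation\<close>

lemma norm_square_diff_le:
  fixes x y :: "'a::real_normed_algebra"
  assumes "norm x \<le> 1" "norm y \<le> 1"
  shows "norm (x * x - y * y) \<le> 2 * norm (x - y)"
  using norm_mult_diff_le[of x y x y] assms by simp

lemma norm_square_commutator_le:
  fixes x r :: "'a::real_normed_algebra"
  assumes "norm r \<le> 1"
  shows "norm (x * (r * r) - r * r * x) \<le> 2 * norm (r * x - x * r)"
proof -
  have "x * (r * r) - r * r * x = - ((r * x - x * r) * r + r * (r * x - x * r))"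
    by (simp add: algebra_simps)
  then have "norm (x * (r * r) - r * r * x) = norm ((r * x - x * r) * r + r * (r * x - x * r))"
    by (simp only: norm_minus_cancel)
  then show ?thesis
    using norm_triangle_ineq[of "(r * x - x * r) * r" "r * (r * x - x * r)"]
      norm_mult_le_contraction[of "r * x - x * r" r] norm_mult_le_contraction[of r "r * x - x * r"] assms
    by linarith
qed

text \<open>Replacing one outer factor at a time costs 3 t times B times the bound 6 for
  \<open>q\<close>, and then 5 t times B.\<close>

lemma norm_sandwich_diff_le:
  fixes p q s x :: "'a::real_normed_algebra"
  assumes "norm s \<le> 1" "norm x \<le> B" "norm (p - s) \<le> 3 * t" "norm (q - s) \<le> 5 * t" "0 \<le> t" "t \<le> 1"
  shows "norm (p * x * q - s * x * s) \<le> 23 * B * t"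
proof -
  have "norm q \<le> norm (q - s) + norm s"
    using norm_triangle_ineq[of "q - s" s] by simp
  then have q: "norm q \<le> 6" using assms by linarith
  have B: "0 \<le> B" using assms(2) norm_ge_zero order_trans by blast
  have "norm ((p - s) * x * q) \<le> norm (p - s) * norm x * norm q"
    by (rule order_trans[OF norm_mult_ineq mult_right_mono[OF norm_mult_ineq norm_ge_zero]])
  also have "\<dots> \<le> (3 * t) * B * 6"
    using assms q B by (intro mult_mono) auto
  finally have 1: "norm ((p - s) * x * q) \<le> (3 * t) * B * 6" .
  have "norm (s * x * (q - s)) \<le> norm (s * x) * norm (q - s)"
    by (rule norm_mult_ineq)
  also have "\<dots> \<le> B * (5 * t)"
    using assms B norm_mult_le_contraction(1)[of s x] by (intro mult_mono) auto
  finally have 2: "norm (s * x * (q - s)) \<le> B * (5 * t)" .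
  have "p * x * q - s * x * s = (p - s) * x * q + s * x * (q - s)"
    by (simp add: algebra_simps)
  then have "norm (p * x * q - s * x * s) \<le> (3 * t) * B * 6 + B * (5 * t)"
    by (simp only:) (rule norm_triangle_mono[OF 1 2])
  then show ?thesis by simp
qed

text \<open>Orthogonality makes the fourth power of the sum equal to the sum of the fourth powers.
  This brings the Rokhlin condition on the sum of the r_g to bear on products of squares.\<close>

lemma orthogonal_sum_power4:
  fixes r :: "'g \<Rightarrow> 'a::real_normed_algebra"
  assumes I: "finite I" and orth: "\<And>g h. \<lbrakk>g \<in> I; h \<in> I; g \<noteq> h\<rbrakk> \<Longrightarrow> r g * r h = 0"
    and R: "R = (\<Sum>g\<in>I. r g)"
  shows "(\<Sum>g\<in>I. r g * r g * (r g * r g) * x) = R * (R * (R * (R * x)))"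
proof -
  have step: "R * (\<Sum>h\<in>I. r h * y h) = (\<Sum>g\<in>I. r g * (r g * y g))" for y
  proof -
    have "R * (\<Sum>h\<in>I. r h * y h) = (\<Sum>g\<in>I. \<Sum>h\<in>I. r g * r h * y h)"
      by (simp add: R sum_product mult.assoc)
    also have "\<dots> = (\<Sum>g\<in>I. \<Sum>h\<in>I. if h = g then r g * r g * y g else 0)"
      using orth by (intro sum.cong) auto
    finally show ?thesis using I by (simp add: mult.assoc)
  qed
  have "R * x = (\<Sum>h\<in>I. r h * x)" by (simp add: R sum_distrib_right)
  then show ?thesis by (simp only: step mult.assoc)
qed

text \<open>Telescoping: R^4 - 1 = (R^3 + R^2 + R + 1)(R - 1), and each of the four terms is at most
  K^3 t since \<open>1 \<le> K\<close>.\<close>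

lemma norm_power4_diff_le:
  fixes R x :: "'a::real_normed_algebra"
  assumes "norm R \<le> K" "1 \<le> K" "norm (R * x - x) \<le> t"
  shows "norm (R * (R * (R * (R * x))) - x) \<le> 4 * K ^ 3 * t"
proof -
  define y where "y = R * x - x"
  have Ry: "norm (R * z) \<le> K * norm z" for z
    using assms by (intro order_trans[OF norm_mult_ineq] mult_right_mono) auto
  have t: "0 \<le> t" using assms(3) norm_ge_zero order_trans by blast
  have 0: "norm y \<le> t" using assms by (simp add: y_def)
  have K: "0 \<le> K" using assms by simp
  have 1: "norm (R * y) \<le> K * t" by (rule order_trans[OF Ry mult_left_mono[OF 0 K]])
  have 2: "norm (R * (R * y)) \<le> K * (K * t)" by (rule order_trans[OF Ry mult_left_mono[OF 1 K]])
  have 3: "norm (R * (R * (R * y))) \<le> K * (K * (K * t))" by (rule order_trans[OF Ry mult_left_mono[OF 2 K]])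
  have "R * (R * (R * (R * x))) - x = R * (R * (R * y)) + R * (R * y) + R * y + y"
    by (simp add: y_def algebra_simps)
  then have "norm (R * (R * (R * (R * x))) - x) \<le> K * (K * (K * t)) + K * (K * t) + K * t + t"
    by (simp only:) (intro norm_triangle_mono 0 1 2 3)
  moreover have a: "t \<le> K * t" using mult_right_mono[OF assms(2) t] by simp
  moreover have b: "K * t \<le> K * (K * t)" by (rule mult_left_mono[OF a K])
  moreover have "K * (K * t) \<le> K * (K * (K * t))" by (rule mult_left_mono[OF b K])
  moreover have "4 * K ^ 3 * t = 4 * (K * (K * (K * t)))" by (simp add: power3_eq_cube)
  ultimately show ?thesis by linarith
qed

context finite_cstar_action begin

text \<open>An element \<open>a\<close> and coefficients \<open>c(g)\<close> such that \<open>v\<^sub>g = c(g) u\<^sub>g\<close> satisfies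
  \<open>v\<^sub>g\<^sup>* v\<^sub>h b = \<delta>\<^sub>g\<^sub>h b\<close> on the hereditary subalgebra of \<open>a\<close>, and \<open>v\<^sub>g a \<approx> r\<^sub>g\<^sup>2 u\<^sub>g\<close>.\<close>

lemma rokhlin_matrix_units:
  assumes "0 < \<tau>"
  obtains \<delta> where "0 < \<delta>" and "\<And>r :: 'g \<Rightarrow> 'a. \<lbrakk>\<And>g. g \<in> carrier G \<Longrightarrow> cstar_positive (r g) \<and> norm (r g) \<le> 1;
      \<And>g h. \<lbrakk>g \<in> carrier G; h \<in> carrier G; g \<noteq> h\<rbrakk> \<Longrightarrow> r g * r h = 0;
      \<And>g. g \<in> carrier G \<Longrightarrow> norm (\<alpha> g (r \<one>) - r g) < \<delta>\<rbrakk> \<Longrightarrow>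
    \<exists>a c. cstar_positive a \<and>
      (\<forall>g\<in>carrier G. \<forall>h\<in>carrier G. g \<noteq> h \<longrightarrow> adj (c g) * c h = 0) \<and>
      (\<forall>g\<in>carrier G. \<alpha> (inv g) (adj (c g) * c g) * a = a) \<and>
      (\<forall>g\<in>carrier G. norm (c g * \<alpha> g a - \<alpha> g (r \<one> * r \<one>)) < \<tau>)"
proof -
  obtain \<delta> where "\<delta> > 0" and \<delta>: "\<And>(s::'a) e d.
    \<lbrakk>sa_contraction s; cstar_positive e; norm e \<le> 1; norm (e - s * s) < \<delta>;
     \<forall>g\<in>carrier G. sa_contraction (d g) \<and> norm (d g - s * s) < \<delta>\<rbrakk> \<Longrightarrow>
    \<exists>a w. cstar_positive a \<and> norm a \<le> 1 \<and> norm (a - s * s) < \<tau> \<and>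
       (\<forall>x. x * e = e \<longrightarrow> x * a = a) \<and>
       (\<forall>g\<in>carrier G. adj (w g) * d g * d g * w g * a = a \<and> norm (d g * w g * a - s * s) < \<tau>)"
    using common_local_unit[OF finite_carrier assms, where 'a = 'a]
    by (elim exE conjE) (rule that, assumption, blast)
  \<comment> \<open>Squaring contractions at most doubles their distance, hence half of
    \<delta>.\<close>
  show ?thesis
  proof (rule that[of "\<delta> / 2"])
    show "0 < \<delta> / 2" using \<open>\<delta> > 0\<close> by simp
    fix r :: "'g \<Rightarrow> 'a"
    assume pos: "\<And>g. g \<in> carrier G \<Longrightarrow> cstar_positive (r g) \<and> norm (r g) \<le> 1"
      and orth: "\<And>g h. \<lbrakk>g \<in> carrier G; h \<in> carrier G; g \<noteq> h\<rbrakk> \<Longrightarrow> r g * r h = 0"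
      and equiv: "\<And>g. g \<in> carrier G \<Longrightarrow> norm (\<alpha> g (r \<one>) - r g) < \<delta> / 2"
    have r: "adj (r g) = r g" "norm (r g) \<le> 1" if "g \<in> carrier G" for g
      using pos[OF that] cstar_positive_selfadjoint by auto
    define s where "s = r \<one>"
    have s: "sa_contraction s" by (simp add: s_def sa_contraction_def r)
    have e: "cstar_positive (s * s)" "norm (s * s) \<le> 1" "norm (s * s - s * s) < \<delta>"
      using s \<open>\<delta> > 0\<close> norm_mult_le_contraction(1)[of s s]
      by (auto simp: cstar_positive_def sa_contraction_def intro!: exI[of _ s])
    define d where "d g = \<alpha> (inv g) (r g * r g)" for g
    have d: "sa_contraction (d g) \<and> norm (d g - s * s) < \<delta>" if g: "g \<in> carrier G" for g
    proof
      have "norm (d g) \<le> norm (r g * r g)"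
        using g by (simp add: d_def norm_\<alpha>_le)
      also have "\<dots> \<le> 1"
        using norm_mult_le_contraction(1)[of "r g" "r g"] r[OF g] by simp
      finally show "sa_contraction (d g)"
        using g by (simp add: sa_contraction_def d_def adj_mult r flip: \<alpha>_adj)
      have "d g - s * s = \<alpha> (inv g) (r g * r g - \<alpha> g s * \<alpha> g s)"
        using g by (simp add: d_def \<alpha>_diff \<alpha>_mult \<alpha>_\<alpha> \<alpha>_one)
      then have "norm (d g - s * s) \<le> norm (r g * r g - \<alpha> g s * \<alpha> g s)"
        using g by (simp add: norm_\<alpha>_le)
      also have "\<dots> \<le> 2 * norm (r g - \<alpha> g s)"
        using g r norm_\<alpha>_le[OF g, of s] s
        by (intro norm_square_diff_le) (auto simp: sa_contraction_def)
      finally show "norm (d g - s * s) < \<delta>"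
        using equiv[OF g] by (simp add: s_def norm_minus_commute)
    qed
    obtain a w where aw: "cstar_positive a \<and> norm a \<le> 1 \<and> norm (a - s * s) < \<tau> \<and>
       (\<forall>x. x * (s * s) = s * s \<longrightarrow> x * a = a) \<and>
       (\<forall>g\<in>carrier G. adj (w g) * d g * d g * w g * a = a \<and> norm (d g * w g * a - s * s) < \<tau>)"
      using \<delta>[OF s e, of d] d by (elim meta_impE exE) (blast, assumption)
    \<comment> \<open>One element in two forms: this one yields the unit equation by undoing
      \<alpha>_g, while the form r_g^2 \<alpha>_g(w_g) inherits orthogonality from
      \<open>r\<close>.\<close>
    define c where "c g = \<alpha> g (d g * w g)" for g
    have c: "c g = r g * r g * \<alpha> g (w g)" if "g \<in> carrier G" for g
      using that by (simp add: c_def d_def \<alpha>_mult \<alpha>_\<alpha> \<alpha>_one)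
    have "adj (c g) * c h = 0" if "g \<in> carrier G" "h \<in> carrier G" "g \<noteq> h" for g h
    proof -
      have "adj (c g) * c h = adj (\<alpha> g (w g)) * r g * (r g * r h) * r h * \<alpha> h (w h)"
        using that by (simp add: c adj_mult r mult.assoc)
      then show ?thesis using orth[OF that] by simp
    qed
    moreover have "\<alpha> (inv g) (adj (c g) * c g) * a = a" if g: "g \<in> carrier G" for g
    proof -
      have "adj (d g) = d g" using d[OF g] by (simp add: sa_contraction_def)
      then have "\<alpha> (inv g) (adj (c g) * c g) = adj (w g) * d g * d g * w g"
        using g by (simp add: c_def \<alpha>_mult \<alpha>_\<alpha> \<alpha>_one adj_mult mult.assoc flip: \<alpha>_adj)
      then show ?thesis using aw g by simp
    qed
    moreover have "norm (c g * \<alpha> g a - \<alpha> g (r \<one> * r \<one>)) < \<tau>" if g: "g \<in> carrier G" for g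
    proof -
      have "c g * \<alpha> g a - \<alpha> g (r \<one> * r \<one>) = \<alpha> g (d g * w g * a - s * s)"
        using g by (simp add: c_def s_def \<alpha>_mult \<alpha>_diff)
      also have "norm \<dots> \<le> norm (d g * w g * a - s * s)"
        using g by (rule norm_\<alpha>_le)
      also have "\<dots> < \<tau>" using aw g by blast
      finally show ?thesis .
    qed
    ultimately show "\<exists>a c. cstar_positive a \<and>
      (\<forall>g\<in>carrier G. \<forall>h\<in>carrier G. g \<noteq> h \<longrightarrow> adj (c g) * c h = 0) \<and>
      (\<forall>g\<in>carrier G. \<alpha> (inv g) (adj (c g) * c g) * a = a) \<and>
      (\<forall>g\<in>carrier G. norm (c g * \<alpha> g a - \<alpha> g (r \<one> * r \<one>)) < \<tau>)"
      using aw by blast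
  qed
qed

lemma unit_on_hereditary:
  assumes "e * a = a" "b \<in> hereditary a"
  shows "e * b = b"
proof -
  have "closed {b. e * b = b}"
    by (intro closed_Collect_eq continuous_intros)
  moreover have "range (\<lambda>x. a * x * a) \<subseteq> {b. e * b = b}"
    using assms(1) by (auto simp flip: mult.assoc)
  ultimately have "hereditary a \<subseteq> {b. e * b = b}"
    unfolding hereditary_def by (rule closure_minimal[rotated])
  then show ?thesis using assms(2) by blast
qed

lemma matrix_approximation:
  assumes rokhlin: "rokhlin_property G \<alpha>" and F: "finite F" and "0 < \<epsilon>"
  shows "\<exists>a \<phi>. cstar_positive a \<and> matrix_star_hom G \<alpha> (card (carrier G)) (hereditary a) \<phi> \<and>
    (\<forall>x\<in>F. crossed_dist G \<alpha> x (\<phi> ` matrices_over (card (carrier G)) (hereditary a)) < \<epsilon>)"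
proof -
  \<comment> \<open>The Rokhlin property is applied to the finitely many coefficients in the algebra
    of the members of \<open>F\<close>.\<close>
  define X where "X = (\<Union>x\<in>F. x ` carrier G)"
  have X: "finite X" using F finite_carrier by (simp add: X_def)
  define B where "B = 1 + (\<Sum>y\<in>X. norm y)"
  have B: "norm y \<le> B" if "y \<in> X" for y
    using member_le_sum[OF that, of norm] X by (simp add: B_def)
  have "1 \<le> B" by (simp add: B_def sum_nonneg)
  define n where "n = card (carrier G)"
  have n: "1 \<le> real n"
    using finite_carrier one_closed by (auto simp: n_def Suc_le_eq card_gt_0_iff)
  \<comment> \<open>Each of the n summands of a coefficient costs 25 B \<tau>, namely 23 for the
    sandwich and 2 for the commutator; the fourth power of the sum costs 4 n^3 \<tau>. The l1-norm
    over all coefficients brings the further factor n in \<tau>.\<close>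
  define C where "C = 25 * B * real n + 4 * real n ^ 3"
  have "0 < C" using n \<open>1 \<le> B\<close> by (simp add: C_def add_pos_pos)
  define \<tau> where "\<tau> = min 1 (\<epsilon> / (2 * (real n * C)))"
  have \<tau>: "0 < \<tau>" "\<tau> \<le> 1"
    using \<open>0 < C\<close> \<open>0 < \<epsilon>\<close> n by (auto simp: \<tau>_def)
  have "real n * C * \<tau> \<le> real n * C * (\<epsilon> / (2 * (real n * C)))"
    using \<open>0 < C\<close> n by (intro mult_left_mono) (auto simp: \<tau>_def)
  also have "\<dots> = \<epsilon> / 2" using \<open>0 < C\<close> n by simp
  finally have small: "real n * C * \<tau> < \<epsilon>" using \<open>0 < \<epsilon>\<close> by linarith

  obtain \<delta> where "0 < \<delta>" and \<delta>: "\<And>r :: 'g \<Rightarrow> 'a. \<lbrakk>\<And>g. g \<in> carrier G \<Longrightarrow> cstar_positive (r g) \<and> norm (r g) \<le> 1;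
      \<And>g h. \<lbrakk>g \<in> carrier G; h \<in> carrier G; g \<noteq> h\<rbrakk> \<Longrightarrow> r g * r h = 0;
      \<And>g. g \<in> carrier G \<Longrightarrow> norm (\<alpha> g (r \<one>) - r g) < \<delta>\<rbrakk> \<Longrightarrow>
    \<exists>a c. cstar_positive a \<and>
      (\<forall>g\<in>carrier G. \<forall>h\<in>carrier G. g \<noteq> h \<longrightarrow> adj (c g) * c h = 0) \<and>
      (\<forall>g\<in>carrier G. \<alpha> (inv g) (adj (c g) * c g) * a = a) \<and>
      (\<forall>g\<in>carrier G. norm (c g * \<alpha> g a - \<alpha> g (r \<one> * r \<one>)) < \<tau>)"
    using rokhlin_matrix_units[OF \<tau>(1)] by blast
  have "0 < min \<delta> \<tau>" using \<open>0 < \<delta>\<close> \<tau> by simp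
  from rokhlin[unfolded rokhlin_property_def, rule_format, OF this X]
  obtain r :: "'g \<Rightarrow> 'a" where r:
    "(\<forall>g\<in>carrier G. cstar_positive (r g) \<and> norm (r g) \<le> 1) \<and>
     (\<forall>g\<in>carrier G. \<forall>h\<in>carrier G. g \<noteq> h \<longrightarrow> r g * r h = 0) \<and>
     (\<forall>g\<in>carrier G. \<forall>h\<in>carrier G. norm (\<alpha> g (r h) - r (g \<otimes> h)) < min \<delta> \<tau>) \<and>
     (\<forall>y\<in>X. \<forall>g\<in>carrier G. norm (r g * y - y * r g) < min \<delta> \<tau>) \<and>
     (\<forall>y\<in>X. norm ((\<Sum>g\<in>carrier G. r g) * y - y) < min \<delta> \<tau>)"
    by (elim exE)
  note r1 = r[THEN conjunct1] and r2 = r[THEN conjunct2, THEN conjunct1]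
    and r3 = r[THEN conjunct2, THEN conjunct2, THEN conjunct1]
    and r4 = r[THEN conjunct2, THEN conjunct2, THEN conjunct2]
  have pos: "cstar_positive (r g) \<and> norm (r g) \<le> 1" if "g \<in> carrier G" for g
    using r1 that by blast
  have orth: "r g * r h = 0" if "g \<in> carrier G" "h \<in> carrier G" "g \<noteq> h" for g h
    using r2 that by blast
  have equiv: "norm (\<alpha> g (r h) - r (g \<otimes> h)) < min \<delta> \<tau>" if "g \<in> carrier G" "h \<in> carrier G" for g h
    using r3 that by blast
  have comm: "norm (r g * y - y * r g) < min \<delta> \<tau>" if "y \<in> X" "g \<in> carrier G" for y g
    using r4 that by blast
  have sum: "norm ((\<Sum>g\<in>carrier G. r g) * y - y) < min \<delta> \<tau>" if "y \<in> X" for y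
    using r4 that by blast
  have equiv1: "norm (\<alpha> g (r \<one>) - r g) < \<delta>" if "g \<in> carrier G" for g
    using equiv[OF that one_closed] that by simp
  have "\<exists>a c. cstar_positive a \<and>
      (\<forall>g\<in>carrier G. \<forall>h\<in>carrier G. g \<noteq> h \<longrightarrow> adj (c g) * c h = 0) \<and>
      (\<forall>g\<in>carrier G. \<alpha> (inv g) (adj (c g) * c g) * a = a) \<and>
      (\<forall>g\<in>carrier G. norm (c g * \<alpha> g a - \<alpha> g (r \<one> * r \<one>)) < \<tau>)"
    by (rule \<delta>[of r]; (rule pos | rule orth | rule equiv1); assumption)
  then obtain a c where ac: "cstar_positive a \<and>
      (\<forall>g\<in>carrier G. \<forall>h\<in>carrier G. g \<noteq> h \<longrightarrow> adj (c g) * c h = 0) \<and>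
      (\<forall>g\<in>carrier G. \<alpha> (inv g) (adj (c g) * c g) * a = a) \<and>
      (\<forall>g\<in>carrier G. norm (c g * \<alpha> g a - \<alpha> g (r \<one> * r \<one>)) < \<tau>)"
    by (elim exE)
  note a = ac[THEN conjunct1] and ac1 = ac[THEN conjunct2, THEN conjunct1]
    and ac2 = ac[THEN conjunct2, THEN conjunct2]
  have c_orth: "adj (c g) * c h = 0" if "g \<in> carrier G" "h \<in> carrier G" "g \<noteq> h" for g h
    using ac1 that by blast
  have c_unit: "\<alpha> (inv g) (adj (c g) * c g) * a = a" if "g \<in> carrier G" for g
    using ac2 that by blast
  have c_close: "norm (c g * \<alpha> g a - \<alpha> g (r \<one> * r \<one>)) < \<tau>" if "g \<in> carrier G" for g
    using ac2 that by blast

  obtain \<gamma> where \<gamma>: "bij_betw \<gamma> (carrier G) {..<n}"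
    using ex_bij_betw_finite_nat[OF finite_carrier] by (auto simp: n_def lessThan_atLeast0)
  define \<phi> where "\<phi> = matrix_map c \<gamma>"
  have hom: "matrix_star_hom G \<alpha> n (hereditary a) \<phi>"
    unfolding \<phi>_def by (intro matrix_star_hom_matrix_map[OF \<gamma>] c_orth unit_on_hereditary[OF c_unit])

  define S where "S g = r g * r g" for g
  have nS: "norm (S g) \<le> 1" if "g \<in> carrier G" for g
    unfolding S_def using pos[OF that] norm_mult_le_contraction(1)[of "r g" "r g"] by linarith
  have S_equiv: "norm (\<alpha> k (S h) - S (k \<otimes> h)) \<le> 2 * \<tau>" if "k \<in> carrier G" "h \<in> carrier G" for k h
  proof -
    have "norm (\<alpha> k (r h)) \<le> 1"
      using norm_\<alpha>_le[OF that(1), of "r h"] pos[OF that(2)] by linarith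
    then have "norm (\<alpha> k (r h) * \<alpha> k (r h) - r (k \<otimes> h) * r (k \<otimes> h)) \<le> 2 * norm (\<alpha> k (r h) - r (k \<otimes> h))"
      using that pos[of "k \<otimes> h"] by (intro norm_square_diff_le) auto
    then show ?thesis
      using equiv[OF that] that by (simp add: S_def \<alpha>_mult)
  qed
  define q where "q g = c g * \<alpha> g a" for g
  have q: "norm (q g - S g) \<le> 3 * \<tau>" if g: "g \<in> carrier G" for g
    using c_close[OF g] S_equiv[OF g one_closed] g
      norm_triangle_ineq[of "c g * \<alpha> g a - \<alpha> g (S \<one>)" "\<alpha> g (S \<one>) - S g"]
    by (simp add: q_def S_def)
  have q': "norm (\<alpha> k (adj (q h)) - S (k \<otimes> h)) \<le> 5 * \<tau>" if "k \<in> carrier G" "h \<in> carrier G" for k h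
  proof -
    have "adj (S h) = S h"
      using pos[OF that(2)] by (simp add: S_def adj_mult cstar_positive_selfadjoint)
    then have "\<alpha> k (adj (q h)) - \<alpha> k (S h) = \<alpha> k (adj (q h - S h))"
      using that by (simp add: adj_diff \<alpha>_diff)
    then have "norm (\<alpha> k (adj (q h)) - \<alpha> k (S h)) \<le> norm (q h - S h)"
      using norm_\<alpha>_le[OF that(1), of "adj (q h - S h)"] by simp
    then show ?thesis
      using q[OF that(2)] S_equiv[OF that]
        norm_triangle_ineq[of "\<alpha> k (adj (q h)) - \<alpha> k (S h)" "\<alpha> k (S h) - S (k \<otimes> h)"]
      by simp
  qed
  have "crossed_dist G \<alpha> x (\<phi> ` matrices_over n (hereditary a)) < \<epsilon>" if x: "x \<in> F" for x
  proof -
    let ?g = "inv_into (carrier G) \<gamma>"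
    define M where "M = mat n n (\<lambda>(i, j). a * \<alpha> (inv (?g i)) (x (?g i \<otimes> inv (?g j))) * a)"
    have "M \<in> matrices_over n (hereditary a)"
      unfolding matrices_over_def M_def elements_mat_def hereditary_def
      by (auto intro!: closure_subset[THEN subsetD])
    have M: "M $$ (\<gamma> g, \<gamma> h) = a * \<alpha> (inv g) (x (g \<otimes> inv h)) * a"
      if "g \<in> carrier G" "h \<in> carrier G" for g h
    proof -
      have "\<gamma> g < n" "\<gamma> h < n" using \<gamma> that by (auto simp: bij_betw_def)
      then show ?thesis
        using that bij_betw_inv_into_left[OF \<gamma>] by (simp add: M_def)
    qed
    have "norm (x k - \<phi> M k) \<le> C * \<tau>" if k: "k \<in> carrier G" for k
    proof -
      have xk: "x k \<in> X" using x k by (auto simp: X_def)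
      define R where "R = (\<Sum>g\<in>carrier G. r g)"
      have R: "norm R \<le> real n"
        unfolding R_def n_def using pos by (intro sum_norm_bound[where K = 1, simplified]) auto
      \<comment> \<open>\<open>S g\<close> almost commutes with \<open>x k\<close>, so the sandwich
        sum is near the sum of r_g^4 x_k, which orthogonality turns into R^4 x_k.\<close>
      have "norm (\<phi> M k - (\<Sum>g\<in>carrier G. S g * S g * x k))
        = norm (\<Sum>g\<in>carrier G. q g * x k * \<alpha> k (adj (q (inv k \<otimes> g))) - S g * S g * x k)"
        by (simp add: \<phi>_def matrix_map_compression[OF \<gamma> cstar_positive_selfadjoint[OF a] k M] sum_subtractf q_def)
      also have "\<dots> \<le> real (card (carrier G)) * (25 * B * \<tau>)"
      proof (rule sum_norm_bound)
        fix g assume g: "g \<in> carrier G"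
        have "norm (\<alpha> k (adj (q (inv k \<otimes> g))) - S g) \<le> 5 * \<tau>"
          using q'[OF k, of "inv k \<otimes> g"] k g by (simp add: mult_inv_cancel)
        then have "norm (q g * x k * \<alpha> k (adj (q (inv k \<otimes> g))) - S g * x k * S g) \<le> 23 * B * \<tau>"
          using nS[OF g] q[OF g] B[OF xk] \<tau> by (intro norm_sandwich_diff_le) auto
        moreover have "norm (S g * x k * S g - S g * S g * x k) \<le> 2 * B * \<tau>"
        proof -
          have "norm (S g * (x k * S g - S g * x k)) \<le> norm (x k * S g - S g * x k)"
            using nS[OF g] by (rule norm_mult_le_contraction(1))
          also have "\<dots> \<le> 2 * norm (r g * x k - x k * r g)"
            unfolding S_def using pos[OF g] by (intro norm_square_commutator_le) auto
          also have "\<dots> \<le> 2 * \<tau>" using comm[OF xk g] by simp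
          also have "\<dots> \<le> 2 * B * \<tau>" using \<open>1 \<le> B\<close> \<tau> by simp
          finally show ?thesis by (simp add: right_diff_distrib mult.assoc)
        qed
        ultimately show "norm (q g * x k * \<alpha> k (adj (q (inv k \<otimes> g))) - S g * S g * x k) \<le> 25 * B * \<tau>"
          using norm_triangle_ineq[of "q g * x k * \<alpha> k (adj (q (inv k \<otimes> g))) - S g * x k * S g" "S g * x k * S g - S g * S g * x k"]
          by simp
      qed
      finally have 1: "norm (\<phi> M k - (\<Sum>g\<in>carrier G. S g * S g * x k)) \<le> 25 * B * real n * \<tau>"
        by (simp add: n_def mult_ac)
      have "norm (R * x k - x k) \<le> \<tau>" using sum[OF xk] by (simp add: R_def)
      then have "norm (R * (R * (R * (R * x k))) - x k) \<le> 4 * real n ^ 3 * \<tau>"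
        by (rule norm_power4_diff_le[OF R n])
      moreover have "(\<Sum>g\<in>carrier G. S g * S g * x k) = R * (R * (R * (R * x k)))"
        unfolding S_def by (rule orthogonal_sum_power4[OF finite_carrier _ R_def]) (rule orth; assumption)
      ultimately have 2: "norm ((\<Sum>g\<in>carrier G. S g * S g * x k) - x k) \<le> 4 * real n ^ 3 * \<tau>"
        by (simp only:)
      have "norm (\<phi> M k - x k) \<le> 25 * B * real n * \<tau> + 4 * real n ^ 3 * \<tau>"
        using norm_triangle_mono[OF 1 2] by simp
      then show ?thesis by (simp add: C_def distrib_right norm_minus_commute)
    qed
    then have "crossed_l1_norm G (crossed_diff G x (\<phi> M)) \<le> real (card (carrier G)) * (C * \<tau>)"
      unfolding crossed_l1_norm_def by (intro sum_bounded_above) (simp add: crossed_diff_def)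
    also have "\<dots> < \<epsilon>" using small by (simp add: n_def mult.assoc)
    finally show ?thesis
      using \<open>M \<in> matrices_over n (hereditary a)\<close> by (intro crossed_dist_less[of "\<phi> M"]) auto
  qed
  then show ?thesis using a hom unfolding n_def by blast
qed

end

theorem theorem2:
  fixes G :: "('g, 'm) monoid_scheme"
    and \<alpha> :: "'g \<Rightarrow> 'a::cstar_algebra \<Rightarrow> 'a"
    and F :: "('g \<Rightarrow> 'a) set"
    and \<epsilon> :: real
  assumes "group G" and "finite (carrier G)"
    and "cstar_action G \<alpha>"
    and "rokhlin_property G \<alpha>"
    and "finite F" and "F \<subseteq> crossed_carrier G"
    and "\<epsilon> > 0"
  shows "\<exists>(a :: 'a) (\<phi> :: 'a mat \<Rightarrow> 'g \<Rightarrow> 'a).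
           cstar_positive a \<and>
           matrix_star_hom G \<alpha> (card (carrier G)) (hereditary a) \<phi> \<and>
           (\<forall>x\<in>F. crossed_dist G \<alpha> x (\<phi> ` matrices_over (card (carrier G)) (hereditary a)) < \<epsilon>)"
proof -
  interpret finite_cstar_action G \<alpha>
    using assms(1-3) by (simp add: finite_cstar_action_def finite_cstar_action_axioms_def)
  show ?thesis
    by (rule matrix_approximation[OF assms(4,5,7)])
qed

end
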